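(* Let $H$ be a nonzero complex Hilbert space, let $\Phi: B(H)\to B(H)$ be a unital positive linear map, let $n\ge2$ be an integer, and let $\mathbb{A}=(A_1,\dots,A_n)$ be an $n$-tuple of positive definite operators in $B(H)$. Put $h_1=\max_{1\le i,j\le n}R(A_i,A_j)$. Then $$\Phi(G(A_1,\dots,A_n))\ \ge\ \left(\frac{2h_1^{1/2}}{1+h_1}\right)^{n-1}G(\Phi(A_1),\dots,\Phi(A_n)),$$ where $G$ denotes the Ando-Li-Mathias geometric mean.
   Context: $B(H)$ is the set of bounded linear operators on $H$; $\le$ is the Loewner order on self-adjoint operators. "Positive definite" means positive and invertible with bounded inverse. A linear map $\Phi$ is positive if $X\ge0$ implies $\Phi(X)\ge 0$, and unital if $\Phi(I)=I$. For positive definite $A,B$, $R(A,B)=\max\{r(A^{-1}B),r(B^{-1}A)\}$, where $r$ is the spectral radius; one has $r(B^{-1}A)=\inf\{\lambda>0: A\le\lambda B\}=\|B^{-1/2}AB^{-1/2}\|$. The Ando-Li-Mathias geometric mean $G(A_1,\dots,A_n)$ of positive definite operators is defined by induction on $n$. For $n=2$, $G(A_1,A_2)=A_1\sharp A_2=A_1^{1/2}(A_1^{-1/2}A_2A_1^{-1/2})^{1/2}A_1^{1/2}$. For $n\ge3$, assuming the mean of $n-1$ operators is defined, set $A_i^{(1)}=A_i$ and $A_i^{(r+1)}=G\big((A_j^{(r)})_{j\ne i}\big)=G(A_1^{(r)},\dots,A_{i-1}^{(r)},A_{i+1}^{(r)},\dots,A_n^{(r)})$ for $r\ge1$, $1\le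 i\le n$. It is known that for each $i$ the limit $\lim_{r\to\infty}A_i^{(r)}$ exists in norm, is positive definite, and does not depend on $i$; this common limit is $G(A_1,\dots,A_n)$. *)

theory Defs
  imports "HOL-Analysis.Analysis"
begin

section \<open>Complex Hilbert spaces\<close>

class scaleC =
  fixes scaleC :: "complex \<Rightarrow> 'a \<Rightarrow> 'a" (infixr \<open>*\<^sub>C\<close> 75)

class complex_vector = scaleC + real_vector +
  assumes scaleC_add_right: "a *\<^sub>C (x + y) = a *\<^sub>C x + a *\<^sub>C y"
    and scaleC_add_left: "(a + b) *\<^sub>C x = a *\<^sub>C x + b *\<^sub>C x"
    and scaleC_scaleC [simp]: "a *\<^sub>C (b *\<^sub>C x) = (a * b) *\<^sub>C x"
    and scaleR_scaleC: "r *\<^sub>R x = complex_of_real r *\<^sub>C x"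

lemma scaleC_one [simp]: "1 *\<^sub>C (x::'a::complex_vector) = x"
  using scaleR_scaleC[of 1 x] by simp

lemma scaleC_zero [simp]: "a *\<^sub>C 0 = (0::'a::complex_vector)"
  using scaleC_add_right[of a 0 0] by simp

lemma vector_space_scaleC: "vector_space (scaleC :: complex \<Rightarrow> 'a \<Rightarrow> 'a::complex_vector)"
  by unfold_locales (simp_all add: scaleC_add_right scaleC_add_left)

text \<open>The inner product is antilinear in the first argument.\<close>

class complex_hilbert_space = complex_vector + banach +
  fixes cinner :: "'a \<Rightarrow> 'a \<Rightarrow> complex"
  assumes cinner_commute: "cinner x y = cnj (cinner y x)"
    and cinner_add_right: "cinner x (y + z) = cinner x y + cinner x z"
    and cinner_scaleC_right: "cinner x (a *\<^sub>C y) = a * cinner x y"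
    and cinner_self: "cinner x x = complex_of_real ((norm x)\<^sup>2)"

class nonzero_space = zero +
  assumes ex_nonzero: "\<exists>x. x \<noteq> 0"

instantiation complex :: complex_hilbert_space
begin

definition "scaleC_complex (a::complex) (x::complex) = a * x"
definition "cinner_complex (x::complex) (y::complex) = cnj x * y"

instance
proof
  fix x :: complex
  show "cinner x x = complex_of_real ((norm x)\<^sup>2)"
    by (metis cinner_complex_def complex_norm_square mult.commute of_real_power)
qed (simp_all add: scaleC_complex_def cinner_complex_def algebra_simps scaleR_conv_of_real)

end

instance complex :: nonzero_space
  by standard (rule exI[of _ 1], simp)

lemma norm_scaleC: "norm (a *\<^sub>C (x::'a::complex_hilbert_space)) = cmod a * norm x"
proof -
  have "complex_of_real ((norm (a *\<^sub>C x))\<^sup>2) = a * cnj (a * cinner x x)"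
    by (metis cinner_self cinner_scaleC_right cinner_commute)
  also have "\<dots> = (a * cnj a) * complex_of_real ((norm x)\<^sup>2)"
    by (simp add: cinner_self)
  also have "\<dots> = complex_of_real ((cmod a * norm x)\<^sup>2)"
    by (simp add: complex_norm_square[symmetric] power_mult_distrib)
  finally have "(norm (a *\<^sub>C x))\<^sup>2 = (cmod a * norm x)\<^sup>2"
    using of_real_eq_iff by blast
  thus ?thesis
    by (simp add: power2_eq_iff_nonneg)
qed

lemma bounded_linear_scaleC: "bounded_linear (scaleC a :: 'a \<Rightarrow> 'a::complex_hilbert_space)"
  by (rule bounded_linear_intro[where K = "cmod a"])
     (simp_all add: scaleC_add_right scaleR_scaleC norm_scaleC mult.commute)

section \<open>The algebra of bounded operators\<close>

typedef (overloaded) 'a bounded_op =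
  "{T :: 'a::complex_hilbert_space \<Rightarrow>\<^sub>L 'a. \<forall>c x. T (c *\<^sub>C x) = c *\<^sub>C T x}"
  morphisms blinfun_of_op op_of_blinfun
  by (rule exI[of _ 0]) simp

setup_lifting type_definition_bounded_op

lift_definition op_apply :: "'a::complex_hilbert_space bounded_op \<Rightarrow> 'a \<Rightarrow> 'a"
  is blinfun_apply .

instantiation bounded_op :: (complex_hilbert_space) complex_vector
begin

lift_definition zero_bounded_op :: "'a bounded_op" is 0
  by simp
lift_definition plus_bounded_op :: "'a bounded_op \<Rightarrow> 'a bounded_op \<Rightarrow> 'a bounded_op" is "(+)"
  by (simp add: blinfun.bilinear_simps scaleC_add_right)
lift_definition minus_bounded_op :: "'a bounded_op \<Rightarrow> 'a bounded_op \<Rightarrow> 'a bounded_op" is "(-)"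
  by (simp add: blinfun.bilinear_simps linear_diff bounded_linear.linear[OF bounded_linear_scaleC])
lift_definition uminus_bounded_op :: "'a bounded_op \<Rightarrow> 'a bounded_op" is "uminus"
  by (simp add: blinfun.bilinear_simps linear_neg bounded_linear.linear[OF bounded_linear_scaleC])
lift_definition scaleR_bounded_op :: "real \<Rightarrow> 'a bounded_op \<Rightarrow> 'a bounded_op" is "scaleR"
  by (simp add: blinfun.bilinear_simps scaleR_scaleC mult.commute)
lift_definition scaleC_bounded_op :: "complex \<Rightarrow> 'a bounded_op \<Rightarrow> 'a bounded_op"
  is "\<lambda>c T. Blinfun (scaleC c) o\<^sub>L T"
  by (simp add: bounded_linear_Blinfun_apply bounded_linear_scaleC mult.commute)

instance
proof
  fix a b :: complex and r :: real and S T :: "'a bounded_op"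
  show "a *\<^sub>C (S + T) = a *\<^sub>C S + a *\<^sub>C T"
    by transfer (simp add: blinfun.bilinear_simps bounded_bilinear.add_right[OF bounded_bilinear_blinfun_compose])
  show "(a + b) *\<^sub>C T = a *\<^sub>C T + b *\<^sub>C T"
    by transfer (auto intro!: blinfun_eqI simp: blinfun.bilinear_simps
        bounded_linear_Blinfun_apply bounded_linear_scaleC scaleC_add_left)
  show "a *\<^sub>C b *\<^sub>C T = (a * b) *\<^sub>C T"
    by transfer (auto intro!: blinfun_eqI simp: bounded_linear_Blinfun_apply bounded_linear_scaleC)
  show "r *\<^sub>R T = complex_of_real r *\<^sub>C T"
    by transfer (auto intro!: blinfun_eqI simp: blinfun.bilinear_simps
        bounded_linear_Blinfun_apply bounded_linear_scaleC scaleR_scaleC)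
qed (transfer; simp add: algebra_simps)+

end

lemma op_apply_scaleC: "op_apply (c *\<^sub>C T) x = c *\<^sub>C op_apply T x"
  by transfer (simp add: bounded_linear_Blinfun_apply bounded_linear_scaleC)

instantiation bounded_op :: (complex_hilbert_space) "{real_normed_algebra, monoid_mult}"
begin

lift_definition one_bounded_op :: "'a bounded_op" is id_blinfun
  by simp
lift_definition times_bounded_op :: "'a bounded_op \<Rightarrow> 'a bounded_op \<Rightarrow> 'a bounded_op" is "(o\<^sub>L)"
  by simp
lift_definition norm_bounded_op :: "'a bounded_op \<Rightarrow> real" is norm .

definition dist_bounded_op :: "'a bounded_op \<Rightarrow> 'a bounded_op \<Rightarrow> real"
  where "dist_bounded_op S T = norm (S - T)"
definition sgn_bounded_op :: "'a bounded_op \<Rightarrow> 'a bounded_op"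
  where "sgn_bounded_op T = T /\<^sub>R norm T"
definition uniformity_bounded_op :: "('a bounded_op \<times> 'a bounded_op) filter"
  where [code del]: "uniformity_bounded_op = (INF e\<in>{0<..}. principal {(x, y). dist x y < e})"
definition open_bounded_op :: "'a bounded_op set \<Rightarrow> bool"
  where [code del]:
    "open_bounded_op U = (\<forall>x\<in>U. eventually (\<lambda>(x', y). x' = x \<longrightarrow> y \<in> U) uniformity)"

instance
proof
  fix R S T :: "'a bounded_op" and a :: real
  show "R * S * T = R * (S * T)"
    by transfer (simp add: blinfun_eqI)
  show "(R + S) * T = R * T + S * T"
    by transfer (simp add: bounded_bilinear.add_left[OF bounded_bilinear_blinfun_compose])
  show "R * (S + T) = R * S + R * T"
    by transfer (simp add: bounded_bilinear.add_right[OF bounded_bilinear_blinfun_compose])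
  show "a *\<^sub>R S * T = a *\<^sub>R (S * T)"
    by transfer (simp add: bounded_bilinear.scaleR_left[OF bounded_bilinear_blinfun_compose])
  show "S * a *\<^sub>R T = a *\<^sub>R (S * T)"
    by transfer (simp add: bounded_bilinear.scaleR_right[OF bounded_bilinear_blinfun_compose])
  show "1 * T = T" "T * 1 = T"
    by (transfer, auto intro!: blinfun_eqI)+
  show "norm T = 0 \<longleftrightarrow> T = 0"
    by transfer simp
  show "norm (S + T) \<le> norm S + norm T"
    by transfer (rule norm_triangle_ineq)
  show "norm (a *\<^sub>R T) = \<bar>a\<bar> * norm T"
    by transfer simp
  show "norm (S * T) \<le> norm S * norm T"
    by transfer (rule norm_blinfun_compose)
qed (simp_all add: dist_bounded_op_def sgn_bounded_op_def uniformity_bounded_op_def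
       open_bounded_op_def)

end

instance bounded_op :: (complex_hilbert_space) banach
proof
  fix X :: "nat \<Rightarrow> 'a bounded_op"
  assume X: "Cauchy X"
  have d: "dist (blinfun_of_op S) (blinfun_of_op T) = dist S T" for S T :: "'a bounded_op"
    by (simp add: dist_norm norm_bounded_op.rep_eq minus_bounded_op.rep_eq)
  have "Cauchy (\<lambda>n. blinfun_of_op (X n))"
    using X by (simp add: Cauchy_def d)
  then obtain L where L: "(\<lambda>n. blinfun_of_op (X n)) \<longlonglongrightarrow> L"
    using Cauchy_convergent convergent_def by blast
  have app: "(\<lambda>n. blinfun_apply (blinfun_of_op (X n)) x) \<longlonglongrightarrow> L x" for x
    by (intro tendsto_intros L)
  have "L (c *\<^sub>C x) = c *\<^sub>C L x" for c x
  proof -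
    have "(\<lambda>n. c *\<^sub>C blinfun_apply (blinfun_of_op (X n)) x) \<longlonglongrightarrow> c *\<^sub>C L x"
      by (rule bounded_linear.tendsto[OF bounded_linear_scaleC app])
    moreover have "c *\<^sub>C blinfun_apply (blinfun_of_op (X n)) x
        = blinfun_apply (blinfun_of_op (X n)) (c *\<^sub>C x)" for n
      using blinfun_of_op[of "X n"] by simp
    ultimately show ?thesis
      using app[of "c *\<^sub>C x"] LIMSEQ_unique by auto
  qed
  hence rep: "blinfun_of_op (op_of_blinfun L) = L"
    by (simp add: op_of_blinfun_inverse)
  have "X \<longlonglongrightarrow> op_of_blinfun L"
    using L unfolding tendsto_iff by (metis (no_types, lifting) d eventually_mono rep)
  thus "convergent X"
    by (auto simp: convergent_def)
qed

instance bounded_op :: ("{complex_hilbert_space, nonzero_space}") real_normed_algebra_1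
proof
  obtain x :: 'a where x: "x \<noteq> 0"
    using ex_nonzero by blast
  have n: "norm (id_blinfun :: 'a \<Rightarrow>\<^sub>L 'a) = 1"
    by (rule norm_blinfun_eqI[of _ _ x]) (use x in simp_all)
  show n1: "norm (1 :: 'a bounded_op) = 1"
    using n by transfer simp
  show "(0 :: 'a bounded_op) \<noteq> 1"
    using n1 by (metis norm_zero zero_neq_one)
qed

section \<open>Order, inverses, square roots, spectral radius\<close>

text \<open>
  On a complex space, nonnegativity of the quadratic form already implies self-adjointness.
  Hence \<open>S \<le> T\<close> says that \<open>T - S\<close> is a positive operator; on self-adjoint operators
  this is the Loewner order.
\<close>

instantiation bounded_op :: (complex_hilbert_space) order
begin

definition less_eq_bounded_op :: "'a bounded_op \<Rightarrow> 'a bounded_op \<Rightarrow> bool"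
  where "S \<le> T \<longleftrightarrow> (\<forall>x. cinner x (op_apply (T - S) x) \<in> \<real>\<^sub>\<ge>\<^sub>0)"
definition less_bounded_op :: "'a bounded_op \<Rightarrow> 'a bounded_op \<Rightarrow> bool"
  where "S < T \<longleftrightarrow> S \<le> T \<and> \<not> T \<le> (S :: 'a bounded_op)"

instance
proof
  fix R S T :: "'a bounded_op"
  have app0: "op_apply 0 x = 0" for x :: 'a
    by transfer simp
  have cinner_add_left: "cinner (x + y) z = cinner x z + cinner y z" for x y z :: 'a
    by (metis cinner_add_right cinner_commute complex_cnj_add)
  have cinner_scaleC_left: "cinner (a *\<^sub>C x) z = cnj a * cinner x z" for a and x z :: 'a
    by (metis cinner_scaleC_right cinner_commute complex_cnj_mult)
  have cinner_zero: "cinner x 0 = 0" for x :: 'a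
    using cinner_add_right[of x 0 0] by simp
  have app_add: "op_apply U (x + y) = op_apply U x + op_apply U y" for U and x y :: 'a
    by transfer (simp add: blinfun.bilinear_simps)
  have app_scaleC: "op_apply U (c *\<^sub>C x) = c *\<^sub>C op_apply U x" for U c and x :: 'a
    by transfer simp
  show "S < T \<longleftrightarrow> S \<le> T \<and> \<not> T \<le> S"
    by (rule less_bounded_op_def)
  show "S \<le> S"
    by (simp add: less_eq_bounded_op_def app0 cinner_zero)
  show "R \<le> T" if "R \<le> S" "S \<le> T"
  proof -
    have "op_apply (T - R) x = op_apply (S - R) x + op_apply (T - S) x" for x
      by transfer (simp add: blinfun.bilinear_simps)
    thus ?thesis
      using that by (simp add: less_eq_bounded_op_def cinner_add_right nonneg_Reals_add_I)
  qed
  show "S = T" if le: "S \<le> T" "T \<le> S"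
  proof -
    define D where "D = T - S"
    have neg: "op_apply (S - T) x + op_apply D x = 0" for x
      unfolding D_def by transfer (simp add: blinfun.bilinear_simps)
    have D0: "cinner x (op_apply D x) = 0" for x
    proof -
      have "cinner x (op_apply (S - T) x) + cinner x (op_apply D x) = 0"
        by (metis neg cinner_add_right cinner_zero)
      moreover have "cinner x (op_apply (S - T) x) \<in> \<real>\<^sub>\<ge>\<^sub>0" "cinner x (op_apply D x) \<in> \<real>\<^sub>\<ge>\<^sub>0"
        using le by (auto simp: less_eq_bounded_op_def D_def)
      ultimately show ?thesis
        by (auto simp: complex_nonneg_Reals_iff complex_eq_iff)
    qed
    have sym: "cinner x (op_apply D y) + cinner y (op_apply D x) = 0" for x y
      using D0[of "x + y"] by (simp add: app_add cinner_add_left cinner_add_right D0 add.commute)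
    have "cinner x (op_apply D y) = 0" for x y
      using sym[of x y] sym[of x "\<i> *\<^sub>C y"]
      by (simp add: app_scaleC cinner_scaleC_right cinner_scaleC_left complex_eq_iff)
    hence "op_apply D y = 0" for y
      by (metis cinner_self norm_eq_zero of_real_eq_0_iff power_eq_0_iff)
    hence "D = 0"
      by transfer (simp add: blinfun_eqI)
    thus ?thesis
      by (simp add: D_def)
  qed
qed

end

definition is_op_inverse :: "'a::complex_hilbert_space bounded_op \<Rightarrow> 'a bounded_op \<Rightarrow> bool"
  where "is_op_inverse T S \<longleftrightarrow> S * T = 1 \<and> T * S = 1"

definition op_invertible :: "'a::complex_hilbert_space bounded_op \<Rightarrow> bool"
  where "op_invertible T \<longleftrightarrow> (\<exists>S. is_op_inverse T S)"

definition op_inv :: "'a::complex_hilbert_space bounded_op \<Rightarrow> 'a bounded_op"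
  where "op_inv T = (THE S. is_op_inverse T S)"

definition pos_def :: "'a::complex_hilbert_space bounded_op \<Rightarrow> bool"
  where "pos_def T \<longleftrightarrow> 0 \<le> T \<and> op_invertible T"

definition op_sqrt :: "'a::complex_hilbert_space bounded_op \<Rightarrow> 'a bounded_op"
  where "op_sqrt T = (THE S. 0 \<le> S \<and> S * S = T)"

definition op_spectrum :: "'a::complex_hilbert_space bounded_op \<Rightarrow> complex set"
  where "op_spectrum T = {c. \<not> op_invertible (T - c *\<^sub>C 1)}"

definition spectral_radius :: "'a::complex_hilbert_space bounded_op \<Rightarrow> real"
  where "spectral_radius T = (SUP c\<in>op_spectrum T. cmod c)"

definition R_dist :: "'a::complex_hilbert_space bounded_op \<Rightarrow> 'a bounded_op \<Rightarrow> real"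
  where "R_dist A B = max (spectral_radius (op_inv A * B)) (spectral_radius (op_inv B * A))"

section \<open>Unital positive linear maps\<close>

definition unital_positive_map ::
    "('a::complex_hilbert_space bounded_op \<Rightarrow> 'a bounded_op) \<Rightarrow> bool"
  where "unital_positive_map \<Phi> \<longleftrightarrow>
    Vector_Spaces.linear scaleC scaleC \<Phi> \<and> (\<forall>X\<ge>0. \<Phi> X \<ge> 0) \<and> \<Phi> 1 = 1"

section \<open>The Ando-Li-Mathias geometric mean\<close>

definition geo_mean2 ::
    "'a::complex_hilbert_space bounded_op \<Rightarrow> 'a bounded_op \<Rightarrow> 'a bounded_op"  (infixl \<open>\<sharp>\<close> 70)
  where "A \<sharp> B =
    op_sqrt A * op_sqrt (op_inv (op_sqrt A) * B * op_inv (op_sqrt A)) * op_sqrt A"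

definition omit :: "nat \<Rightarrow> (nat \<Rightarrow> 'b) \<Rightarrow> nat \<Rightarrow> 'b"
  where "omit i A = (\<lambda>j. if j < i then A j else A (Suc j))"

text \<open>
  \<open>alm_mean n A\<close> is the mean of the \<open>n\<close>-tuple \<open>A 0, \<dots>, A (n - 1)\<close>; the other values of \<open>A\<close>
  are irrelevant, and only \<open>n \<ge> 2\<close> is meaningful. For \<open>n \<ge> 3\<close> the iteration replaces all
  entries simultaneously, the new \<open>i\<close>-th entry being the mean of the \<open>n - 1\<close> old entries
  other than the \<open>i\<close>-th, and the mean is the common norm limit of all \<open>n\<close> entries.
\<close>

primrec alm_mean ::
    "nat \<Rightarrow> (nat \<Rightarrow> 'a::complex_hilbert_space bounded_op) \<Rightarrow> 'a bounded_op"
  where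
    "alm_mean 0 = (\<lambda>A. A 0)"
  | "alm_mean (Suc m) = (\<lambda>A.
      if m = 0 then A 0
      else if m = 1 then A 0 \<sharp> A 1
      else THE L. \<forall>i<Suc m.
        (\<lambda>r. (((\<lambda>B k. alm_mean m (omit k B)) ^^ r) A) i) \<longlonglongrightarrow> L)"

end

theory Submission
  imports Defs
begin

text \<open>
  The inequality is two comparisons with the arithmetic mean, which commutes with \<open>\<Phi>\<close>.
  Put \<open>h = exp (2 t)\<close>, so that \<open>(1 + h) / (2 \<surd>h) = cosh t\<close>. If all ratios within the
  tuple are bounded by \<open>h\<close>, then
  \<open>A 0 + \<dots> + A (n - 1) \<le> n (cosh t)\<^sup>n\<^sup>-\<^sup>1 G(A)\<close>, a reverse of the
  arithmetic-geometric mean inequality. Applying \<open>\<Phi>\<close>, and then the inequality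
  \<open>n G(B) \<le> B 0 + \<dots> + B (n - 1)\<close> to \<open>B i = \<Phi> (A i)\<close>, gives the claim.

  Both inequalities, and the convergence of the iteration that defines \<open>G\<close>, are proved by one
  induction on the number of operators, whose hypothesis is the locale
  \<open>geometric_mean_bounds\<close>. The third ingredient in it is a comparison principle: if
  \<open>A i \<le> exp (l i) B (\<sigma> i)\<close> for a permutation \<open>\<sigma>\<close>, then \<open>G(A) \<le> exp m G(B)\<close>, where \<open>m\<close>
  is the mean of the \<open>l i\<close>. For the step from \<open>n\<close> to \<open>n + 1\<close> operators, the comparison
  principle shows that one round of the iteration divides the spread \<open>t\<close> by \<open>n\<close>. By the
  other two inequalities, the sum of the entries decreases in each round, but at most by the
  factor \<open>(cosh t)\<^sup>n\<^sup>-\<^sup>1\<close> with the current \<open>t\<close>. Since \<open>(cosh (t / n))\<^sup>n \<le> cosh t\<close>, the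
  product of all these factors is at most \<open>(cosh t)\<^sup>n\<close>, which is the exponent required for
  \<open>n + 1\<close> operators. The same estimate makes the sums a Cauchy sequence in norm; the entries
  themselves follow because their spread tends to 0.

  For two operators everything comes from the Riccati equation \<open>X A\<inverse> X = B\<close>, whose positive
  definite solution is \<open>A \<sharp> B\<close> (\<open>le_geo_mean2I\<close>, \<open>geo_mean2_eqI\<close>), and from the operator
  monotonicity of the square root (\<open>le_if_square_le\<close>). Finally, \<open>le_spectral_radius_scaleR\<close>
  turns the bound on spectral radii into the order bounds \<open>A i \<le> h A j\<close>.
\<close>

section \<open>Quadratic forms and the Loewner order\<close>

lemma cinner_add_left: "cinner (x + y) z = cinner x z + cinner (y::'a::complex_hilbert_space) z"
  by (metis cinner_add_right cinner_commute complex_cnj_add)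

lemma cinner_scaleC_left: "cinner (a *\<^sub>C x) z = cnj a * cinner x (z::'a::complex_hilbert_space)"
  by (metis cinner_scaleC_right cinner_commute complex_cnj_mult)

lemma cinner_zero_right [simp]: "cinner x (0::'a::complex_hilbert_space) = 0"
  using cinner_add_right[of x 0 0] by simp

lemma cinner_zero_left [simp]: "cinner (0::'a::complex_hilbert_space) x = 0"
  by (metis cinner_zero_right cinner_commute complex_cnj_zero)

lemma cinner_scaleR_right: "cinner x (r *\<^sub>R y) = r *\<^sub>R cinner x (y::'a::complex_hilbert_space)"
  unfolding scaleR_scaleC[of r y] cinner_scaleC_right scaleR_conv_of_real ..

lemma cinner_scaleR_left: "cinner (r *\<^sub>R x) y = r *\<^sub>R cinner x (y::'a::complex_hilbert_space)"
  unfolding scaleR_scaleC[of r x] cinner_scaleC_left scaleR_conv_of_real by simp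

lemma cinner_minus_right [simp]: "cinner x (- y) = - cinner x (y::'a::complex_hilbert_space)"
  using cinner_scaleR_right[of x "-1" y] by simp

lemma cinner_minus_left [simp]: "cinner (- x) y = - cinner x (y::'a::complex_hilbert_space)"
  using cinner_scaleR_left[of "-1" x y] by simp

lemma cinner_diff_right: "cinner x (y - z) = cinner x y - cinner x (z::'a::complex_hilbert_space)"
  using cinner_add_right[of x y "- z"] by simp

lemma cinner_diff_left: "cinner (x - y) z = cinner x z - cinner y (z::'a::complex_hilbert_space)"
  using cinner_add_left[of x "- y" z] by simp

lemma Re_cinner_commute: "Re (cinner x y) = Re (cinner y (x::'a::complex_hilbert_space))"
  by (subst cinner_commute) simp

lemma power2_norm_eq_cinner: "(norm x)\<^sup>2 = Re (cinner x (x::'a::complex_hilbert_space))"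
  by (simp add: cinner_self)

lemma power2_norm_add:
  "(norm (x + y))\<^sup>2 = (norm x)\<^sup>2 + 2 * Re (cinner x y) + (norm (y::'a::complex_hilbert_space))\<^sup>2"
  using Re_cinner_commute[of x y]
  by (simp only: power2_norm_eq_cinner cinner_add_left cinner_add_right plus_complex.sel)

lemma power2_norm_diff:
  "(norm (x - y))\<^sup>2 = (norm x)\<^sup>2 - 2 * Re (cinner x y) + (norm (y::'a::complex_hilbert_space))\<^sup>2"
  using power2_norm_add[of x "- y"] by simp

lemma Re_cinner_le_norm: "Re (cinner x y) \<le> norm x * norm (y::'a::complex_hilbert_space)"
proof -
  have "(norm (x + y))\<^sup>2 \<le> (norm x + norm y)\<^sup>2"
    by (simp add: norm_triangle_ineq power_mono)
  thus ?thesis by (simp add: power2_norm_add power2_sum)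
qed

lemma op_apply_add_left [simp]: "op_apply (S + T) x = op_apply S x + op_apply T x"
  by transfer (simp add: blinfun.bilinear_simps)
lemma op_apply_diff_left [simp]: "op_apply (S - T) x = op_apply S x - op_apply T x"
  by transfer (simp add: blinfun.bilinear_simps)
lemma op_apply_minus_left [simp]: "op_apply (- T) x = - op_apply T x"
  by transfer (simp add: blinfun.bilinear_simps)
lemma op_apply_scaleR_left [simp]: "op_apply (r *\<^sub>R T) x = r *\<^sub>R op_apply T x"
  by transfer (simp add: blinfun.bilinear_simps)
lemma op_apply_0_left [simp]: "op_apply 0 x = 0"
  by transfer simp
lemma op_apply_one [simp]: "op_apply 1 x = x"
  by transfer simp
lemma op_apply_times [simp]: "op_apply (S * T) x = op_apply S (op_apply T x)"
  by transfer simp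
lemma op_apply_add_right: "op_apply T (x + y) = op_apply T x + op_apply T y"
  by transfer (simp add: blinfun.bilinear_simps)
lemma op_apply_diff_right: "op_apply T (x - y) = op_apply T x - op_apply T y"
  by transfer (simp add: blinfun.bilinear_simps)
lemma op_apply_scaleC_right: "op_apply T (c *\<^sub>C x) = c *\<^sub>C op_apply T x"
  by transfer simp

lemma op_eqI: "(\<And>x. op_apply S x = op_apply T x) \<Longrightarrow> S = T"
  by transfer (simp add: blinfun_eqI)

lemma norm_op_apply: "norm (op_apply T x) \<le> norm T * norm x"
  by transfer (rule norm_blinfun)

lemma norm_op_bound:
  "0 \<le> c \<Longrightarrow> (\<And>x. norm (op_apply T x) \<le> c * norm x) \<Longrightarrow> norm T \<le> c"
  by transfer (rule norm_blinfun_bound)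

definition hermitian :: "'a::complex_hilbert_space bounded_op \<Rightarrow> bool"
  where "hermitian T \<longleftrightarrow> (\<forall>x y. cinner (op_apply T x) y = cinner x (op_apply T y))"

definition qform :: "'a::complex_hilbert_space bounded_op \<Rightarrow> 'a \<Rightarrow> real"
  where "qform T x = Re (cinner x (op_apply T x))"

lemma qform_add [simp]: "qform (S + T) x = qform S x + qform T x"
  by (simp add: qform_def cinner_add_right)
lemma qform_diff [simp]: "qform (S - T) x = qform S x - qform T x"
  by (simp add: qform_def cinner_diff_right)
lemma qform_minus [simp]: "qform (- T) x = - qform T x"
  by (simp add: qform_def)
lemma qform_scaleR [simp]: "qform (r *\<^sub>R T) x = r * qform T x"
  by (simp add: qform_def cinner_scaleR_right)
lemma qform_zero [simp]: "qform 0 x = 0"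
  by (simp add: qform_def)
lemma qform_one [simp]: "qform 1 x = (norm x)\<^sup>2"
  by (simp add: qform_def power2_norm_eq_cinner)

lemma qform_square: "hermitian T \<Longrightarrow> qform (T * T) x = (norm (op_apply T x))\<^sup>2"
  unfolding hermitian_def qform_def power2_norm_eq_cinner by simp

lemma hermitian_add: "hermitian S \<Longrightarrow> hermitian T \<Longrightarrow> hermitian (S + T)"
  by (simp add: hermitian_def cinner_add_left cinner_add_right)
lemma hermitian_diff: "hermitian S \<Longrightarrow> hermitian T \<Longrightarrow> hermitian (S - T)"
  by (simp add: hermitian_def cinner_diff_left cinner_diff_right)
lemma hermitian_minus: "hermitian T \<Longrightarrow> hermitian (- T)"
  by (simp add: hermitian_def)
lemma hermitian_scaleR: "hermitian T \<Longrightarrow> hermitian (r *\<^sub>R T)"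
  by (simp add: hermitian_def cinner_scaleR_left cinner_scaleR_right)
lemma hermitian_zero [simp]: "hermitian 0"
  by (simp add: hermitian_def)
lemma hermitian_one [simp]: "hermitian 1"
  by (simp add: hermitian_def)
lemma hermitian_square: "hermitian T \<Longrightarrow> hermitian (T * T)"
  by (simp add: hermitian_def)

lemmas hermitian_intros = hermitian_add hermitian_diff hermitian_minus hermitian_scaleR
  hermitian_zero hermitian_one hermitian_square

text \<open>Polarization: over the complex numbers a real quadratic form comes from a
  self-adjoint operator.\<close>

lemma hermitian_iff_real_form: "hermitian T \<longleftrightarrow> (\<forall>x. cinner x (op_apply T x) \<in> \<real>)"
proof
  assume h: "hermitian T"
  show "\<forall>x. cinner x (op_apply T x) \<in> \<real>"
  proof
    fix x
    have "cinner x (op_apply T x) = cnj (cinner x (op_apply T x))"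
      using h unfolding hermitian_def by (metis cinner_commute)
    thus "cinner x (op_apply T x) \<in> \<real>" by (simp add: Reals_cnj_iff)
  qed
next
  assume r: "\<forall>x. cinner x (op_apply T x) \<in> \<real>"
  have im: "Im (cinner x (op_apply T x)) = 0" for x
    using r by (simp add: complex_is_Real_iff)
  have 1: "Im (cinner x (op_apply T y)) + Im (cinner y (op_apply T x)) = 0" for x y
    using im[of "x + y"] im[of x] im[of y]
    by (simp add: op_apply_add_right cinner_add_left cinner_add_right)
  have "cinner x (op_apply T y) = cnj (cinner y (op_apply T x))" for x y
    using 1[of x y] 1[of x "\<i> *\<^sub>C y"]
    by (simp add: op_apply_scaleC_right cinner_scaleC_left cinner_scaleC_right complex_eq_iff)
  thus "hermitian T"
    unfolding hermitian_def by (metis cinner_commute)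
qed

lemma op_le_iff: "S \<le> T \<longleftrightarrow> hermitian (T - S) \<and> (\<forall>x. qform S x \<le> qform T x)"
proof -
  have "S \<le> T \<longleftrightarrow> (\<forall>x. cinner x (op_apply (T - S) x) \<in> \<real> \<and> 0 \<le> qform (T - S) x)"
    unfolding less_eq_bounded_op_def
    by (simp only: complex_nonneg_Reals_iff complex_is_Real_iff qform_def conj_commute)
  thus ?thesis by (auto simp: hermitian_iff_real_form)
qed

lemma op_leI: "hermitian S \<Longrightarrow> hermitian T \<Longrightarrow> (\<And>x. qform S x \<le> qform T x) \<Longrightarrow> S \<le> T"
  by (simp add: op_le_iff hermitian_diff)

lemma qform_mono: "S \<le> T \<Longrightarrow> qform S x \<le> qform T x"
  by (simp add: op_le_iff)

lemma hermitian_if_nonneg: "0 \<le> T \<Longrightarrow> hermitian T"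
  by (simp add: op_le_iff)

lemma nonneg_one: "0 \<le> (1 :: 'a::complex_hilbert_space bounded_op)"
  by (rule op_leI) auto

instance bounded_op :: (complex_hilbert_space) ordered_real_vector
proof
  fix R S T :: "'a bounded_op" and a b :: real
  show "S \<le> T \<Longrightarrow> R + S \<le> R + T"
    by (simp add: op_le_iff)
  show "S \<le> T \<Longrightarrow> 0 \<le> a \<Longrightarrow> a *\<^sub>R S \<le> a *\<^sub>R T"
    by (simp add: op_le_iff mult_left_mono hermitian_scaleR flip: scaleR_diff_right)
  show "a \<le> b \<Longrightarrow> 0 \<le> T \<Longrightarrow> a *\<^sub>R T \<le> b *\<^sub>R T"
    by (simp add: op_le_iff mult_right_mono hermitian_scaleR flip: scaleR_diff_left)
qed

lemma congruence_mono:
  assumes "hermitian C" and "S \<le> T"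
  shows "C * S * C \<le> C * T * C"
proof -
  have "cinner x (op_apply (C * T * C - C * S * C) x)
      = cinner (op_apply C x) (op_apply (T - S) (op_apply C x))" for x
    using assms(1) by (simp add: hermitian_def cinner_diff_right)
  thus ?thesis
    using assms(2) unfolding less_eq_bounded_op_def by presburger
qed

lemma square_nonneg: "hermitian T \<Longrightarrow> 0 \<le> T * T"
  by (rule op_leI) (auto simp: hermitian_square qform_square)

lemma hermitian_le_norm: 
  assumes "hermitian T" shows "T \<le> norm T *\<^sub>R 1"
proof (rule op_leI)
  fix x
  have "qform T x \<le> norm x * norm (op_apply T x)"
    unfolding qform_def by (rule Re_cinner_le_norm)
  also have "\<dots> \<le> norm x * (norm T * norm x)"
    by (intro mult_left_mono norm_op_apply) auto
  finally show "qform T x \<le> qform (norm T *\<^sub>R 1) x"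
    by (simp add: power2_eq_square algebra_simps)
qed (use assms in \<open>auto intro: hermitian_intros\<close>)

lemma hermitian_ge_minus_norm: "hermitian T \<Longrightarrow> - (norm T *\<^sub>R 1) \<le> T"
  using hermitian_le_norm[of "- T"] by (simp add: hermitian_minus minus_le_iff)

text \<open>The norm of a self-adjoint operator is controlled by its quadratic form alone. This
  is what turns order estimates into norm estimates.\<close>

lemma norm_le_if_bounds:
  fixes T :: "'a::complex_hilbert_space bounded_op"
  assumes "- (c *\<^sub>R 1) \<le> T" and "T \<le> c *\<^sub>R 1" and "0 \<le> c"
  shows "norm T \<le> c"
proof (cases "c = 0")
  case True
  thus ?thesis using assms by (simp add: order_antisym)
next
  case False
  hence c: "c > 0" using assms by simp
  have "0 \<le> c *\<^sub>R 1 - T" using assms by simp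
  hence h: "hermitian (c *\<^sub>R 1 - (c *\<^sub>R 1 - T))"
    by (intro hermitian_intros hermitian_if_nonneg)
  hence h: "hermitian T" by simp
  show ?thesis
  proof (rule norm_op_bound[OF assms(3)])
    fix x
    \<comment> \<open>Compare the forms at \<open>x + y\<close> and \<open>x - y\<close>; the parallelogram identity makes
      \<open>y = T x / c\<close> the optimal choice.\<close>
    define y where "y = (1/c) *\<^sub>R op_apply T x"
    have "qform T (x + y) - qform T (x - y) = 2 * Re (cinner x (op_apply T y)) + 2 * Re (cinner y (op_apply T x))"
      by (simp add: qform_def op_apply_add_right op_apply_diff_right cinner_add_left cinner_add_right
          cinner_diff_left cinner_diff_right algebra_simps)
    also have "Re (cinner x (op_apply T y)) = Re (cinner y (op_apply T x))"
      using h unfolding hermitian_def by (metis Re_cinner_commute)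
    also have "Re (cinner y (op_apply T x)) = (norm (op_apply T x))\<^sup>2 / c"
      by (simp add: y_def cinner_scaleR_left power2_norm_eq_cinner)
    finally have "4 * ((norm (op_apply T x))\<^sup>2 / c) = qform T (x + y) - qform T (x - y)" by simp
    also have "\<dots> \<le> c * (norm (x + y))\<^sup>2 + c * (norm (x - y))\<^sup>2"
      using qform_mono[OF assms(2), of "x + y"] qform_mono[OF assms(1), of "x - y"] by simp
    also have "\<dots> = 2 * c * (norm x)\<^sup>2 + 2 * c * (norm y)\<^sup>2"
      by (simp add: power2_norm_add power2_norm_diff algebra_simps)
    also have "(norm y)\<^sup>2 = (norm (op_apply T x))\<^sup>2 / c\<^sup>2"
      by (simp add: y_def power_divide)
    finally have "(norm (op_apply T x))\<^sup>2 \<le> (c * norm x)\<^sup>2"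
      using c by (simp add: field_simps power2_eq_square)
    thus "norm (op_apply T x) \<le> c * norm x"
      using c by (simp add: power2_le_iff_abs_le)
  qed
qed

lemma norm_le_if_nonneg:
  fixes T :: "'a::complex_hilbert_space bounded_op"
  shows "0 \<le> T \<Longrightarrow> T \<le> c *\<^sub>R 1 \<Longrightarrow> 0 \<le> c \<Longrightarrow> norm T \<le> c"
  by (rule norm_le_if_bounds) (auto intro: order_trans[of _ 0] simp: scaleR_nonneg_nonneg nonneg_one)

lemma op_norm_mono:
  fixes S T :: "'a::complex_hilbert_space bounded_op"
  shows "0 \<le> S \<Longrightarrow> S \<le> T \<Longrightarrow> norm S \<le> norm T"
  by (rule norm_le_if_nonneg)
     (auto intro: order_trans[OF _ hermitian_le_norm] hermitian_if_nonneg order_trans)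

text \<open>The product of the commuting positive operators \<open>T\<close> and \<open>c - T\<close> is positive, because
  \<open>T\<close> lies within \<open>c / 2\<close> of the scalar \<open>c / 2\<close> in norm. The inequality also plays the part of the
  Cauchy-Schwarz inequality for the form of \<open>T\<close>.\<close>

lemma square_le_scaleR:
  fixes T :: "'a::complex_hilbert_space bounded_op"
  assumes "0 \<le> T" and "T \<le> c *\<^sub>R 1" and "0 \<le> c"
  shows "T * T \<le> c *\<^sub>R T"
proof (rule op_leI)
  have h: "hermitian T" by (rule hermitian_if_nonneg[OF assms(1)])
  show "hermitian (T * T)" "hermitian (c *\<^sub>R T)" using h by (auto intro: hermitian_intros)
  fix x
  have one: "(c/2) *\<^sub>R 1 + (c/2) *\<^sub>R (1::'a bounded_op) = c *\<^sub>R 1"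
    by (simp flip: scaleR_add_left)
  have n: "norm (T - (c/2) *\<^sub>R 1) \<le> c/2"
  proof (rule norm_le_if_bounds)
    show "- ((c / 2) *\<^sub>R 1) \<le> T - (c / 2) *\<^sub>R 1" using assms(1) by simp
    show "T - (c / 2) *\<^sub>R 1 \<le> (c / 2) *\<^sub>R 1" using assms(2) by (simp add: diff_le_eq one)
  qed (use assms in simp)
  have "norm (op_apply T x - (c/2) *\<^sub>R x) \<le> c/2 * norm x"
    using norm_op_apply[of "T - (c/2) *\<^sub>R 1" x] mult_right_mono[OF n, of "norm x"] by simp
  hence "(norm (op_apply T x - (c/2) *\<^sub>R x))\<^sup>2 \<le> (c/2 * norm x)\<^sup>2"
    by (simp add: power_mono)
  hence "(norm (op_apply T x))\<^sup>2 \<le> c * Re (cinner (op_apply T x) x)"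
    unfolding power2_norm_diff by (simp add: cinner_scaleR_right power_mult_distrib power_divide)
  thus "qform (T * T) x \<le> qform (c *\<^sub>R T) x"
    using qform_square[OF h, of x] by (simp add: qform_def Re_cinner_commute cinner_scaleR_right)
qed

text \<open>The order is closed under norm limits, since each value of a form is a bounded
  linear functional of the operator.\<close>

lemma op_le_tendsto:
  fixes L M :: "'a::complex_hilbert_space bounded_op"
  assumes "X \<longlonglongrightarrow> L" and "Y \<longlonglongrightarrow> M" and "\<And>n::nat. X n \<le> Y n"
  shows "L \<le> M"
proof -
  have bl: "bounded_linear (\<lambda>T::'a bounded_op. cinner x (op_apply T x))" for x
  proof (rule bounded_linear_intro)
    fix T :: "'a bounded_op"
    have 1: "\<bar>Re (cinner u v)\<bar> \<le> norm u * norm v" for u v :: 'a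
      using Re_cinner_le_norm[of u v] Re_cinner_le_norm[of u "- v"] by simp
    have 2: "\<bar>Im (cinner u v)\<bar> \<le> norm u * norm v" for u v :: 'a
      using 1[of u "\<i> *\<^sub>C v"] by (simp add: cinner_scaleC_right norm_scaleC)
    have "cmod (cinner x (op_apply T x)) \<le> 2 * (norm x * norm (op_apply T x))"
      using cmod_le[of "cinner x (op_apply T x)"] 1[of x "op_apply T x"] 2[of x "op_apply T x"] by simp
    also have "\<dots> \<le> 2 * (norm x * (norm T * norm x))"
      by (intro mult_left_mono norm_op_apply) auto
    finally show "cmod (cinner x (op_apply T x)) \<le> norm T * (2 * norm x * norm x)"
      by (simp add: algebra_simps)
  qed (simp_all add: cinner_add_right cinner_scaleR_right)
  show ?thesis
    unfolding less_eq_bounded_op_def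
  proof
    fix x
    have "(\<lambda>n. cinner x (op_apply (Y n - X n) x)) \<longlonglongrightarrow> cinner x (op_apply (M - L) x)"
      by (intro bounded_linear.tendsto[OF bl] tendsto_diff assms)
    moreover have "cinner x (op_apply (Y n - X n) x) \<in> \<real>\<^sub>\<ge>\<^sub>0" for n
      using assms(3) unfolding less_eq_bounded_op_def by blast
    ultimately show "cinner x (op_apply (M - L) x) \<in> \<real>\<^sub>\<ge>\<^sub>0"
      using closed_sequentially[OF closed_nonneg_Reals_complex, of "\<lambda>n. cinner x (op_apply (Y n - X n) x)"]
      by blast
  qed
qed

text \<open>The infimum is attained because the order is closed. The least multiple serves as a
  substitute for the extremal point of a spectrum.\<close>

lemma least_multiple:
  fixes X Y :: "'a::complex_hilbert_space bounded_op"
  assumes "0 \<le> b" and "X \<le> b *\<^sub>R Y"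
  obtains c where "0 \<le> c" "X \<le> c *\<^sub>R Y" "\<And>d. 0 \<le> d \<Longrightarrow> X \<le> d *\<^sub>R Y \<Longrightarrow> c \<le> d"
proof -
  define M where "M = {d. 0 \<le> d \<and> X \<le> d *\<^sub>R Y}"
  have "closed M"
    unfolding closed_sequential_limits
  proof safe
    fix d l assume d: "\<forall>n. d n \<in> M" "d \<longlonglongrightarrow> l"
    have "X \<le> l *\<^sub>R Y"
      by (rule op_le_tendsto[of "\<lambda>_. X" _ "\<lambda>n. d n *\<^sub>R Y"])
         (use d in \<open>auto simp: M_def intro!: tendsto_intros\<close>)
    moreover have "0 \<le> l"
      using d by (intro LIMSEQ_le_const[OF d(2)]) (auto simp: M_def)
    ultimately show "l \<in> M" by (simp add: M_def)
  qed
  moreover have "bdd_below M" "M \<noteq> {}"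
    using assms by (auto simp: M_def bdd_below_def)
  ultimately have "Inf M \<in> M" "\<And>d. d \<in> M \<Longrightarrow> Inf M \<le> d"
    by (auto intro: closed_contains_Inf cInf_lower)
  thus ?thesis using that[of "Inf M"] by (auto simp: M_def)
qed

section \<open>Positive definite operators\<close>

lemma is_op_inverse_unique: "is_op_inverse T R \<Longrightarrow> is_op_inverse T S \<Longrightarrow> R = S"
  unfolding is_op_inverse_def by (metis mult.assoc mult_1_left mult_1_right)

lemma op_inv_eqI: "S * T = 1 \<Longrightarrow> T * S = 1 \<Longrightarrow> op_inv T = S"
  unfolding op_inv_def
  by (rule the_equality) (auto intro: is_op_inverse_unique simp: is_op_inverse_def)

lemma op_invertibleI: "S * T = 1 \<Longrightarrow> T * S = 1 \<Longrightarrow> op_invertible T"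
  by (auto simp: op_invertible_def is_op_inverse_def)

lemma op_inv_left: "op_invertible T \<Longrightarrow> op_inv T * T = 1"
  and op_inv_right: "op_invertible T \<Longrightarrow> T * op_inv T = 1"
  by (auto simp: op_invertible_def is_op_inverse_def op_inv_eqI)

lemma op_invertible_scaleR:
  assumes "op_invertible T" and "c \<noteq> 0"
  shows "op_invertible (c *\<^sub>R T)"
  by (rule op_invertibleI[of "(1/c) *\<^sub>R op_inv T"])
     (use assms in \<open>auto simp: op_inv_left op_inv_right\<close>)

lemma op_invertible_mult:
  assumes "op_invertible S" and "op_invertible T"
  shows "op_invertible (S * T)"
proof (rule op_invertibleI)
  have "op_inv T * op_inv S * (S * T) = op_inv T * (op_inv S * S) * T"
    by (simp only: mult.assoc)
  thus "op_inv T * op_inv S * (S * T) = 1" using assms by (simp add: op_inv_left)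
  have "S * T * (op_inv T * op_inv S) = S * (T * op_inv T) * op_inv S"
    by (simp only: mult.assoc)
  thus "S * T * (op_inv T * op_inv S) = 1" using assms by (simp add: op_inv_right)
qed

text \<open>By the contraction principle \<open>Y = 1 + X Y\<close> and \<open>Z = 1 + Z X\<close> have solutions; these are
  a right and a left inverse.\<close>

lemma op_invertible_one_minus:
  fixes X :: "'a::complex_hilbert_space bounded_op"
  assumes "norm X < 1"
  shows "op_invertible (1 - X)"
proof -
  have "\<exists>!Y. 1 + X * Y = Y"
  proof (rule banach_fix_type; (intro allI)?)
    fix Y Z :: "'a bounded_op"
    have "dist (1 + X * Y) (1 + X * Z) = norm (X * (Y - Z))"
      by (simp add: dist_norm algebra_simps)
    thus "dist (1 + X * Y) (1 + X * Z) \<le> norm X * dist Y Z"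
      by (simp add: norm_mult_ineq dist_norm)
  qed (use assms in auto)
  then obtain Y where "1 + X * Y = Y" by blast
  hence Y: "(1 - X) * Y = 1" by (simp add: left_diff_distrib diff_eq_eq)
  have "\<exists>!Y. 1 + Y * X = Y"
  proof (rule banach_fix_type; (intro allI)?)
    fix Y Z :: "'a bounded_op"
    have "dist (1 + Y * X) (1 + Z * X) = norm ((Y - Z) * X)"
      by (simp add: dist_norm algebra_simps)
    thus "dist (1 + Y * X) (1 + Z * X) \<le> norm X * dist Y Z"
      using norm_mult_ineq[of "Y - Z" X] by (simp add: dist_norm mult.commute)
  qed (use assms in auto)
  then obtain Z where "1 + Z * X = Z" by blast
  hence Z: "Z * (1 - X) = 1" by (simp add: right_diff_distrib diff_eq_eq)
  have "Z = Y" using Y Z by (metis mult.assoc mult_1_left mult_1_right)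
  thus ?thesis using Y Z by (blast intro: op_invertibleI)
qed

text \<open>Positive definite means bounded below by a positive multiple of the identity. By
  this criterion the property passes to larger operators and to images under unital positive maps.\<close>

lemma pos_def_iff_bounded_below:
  fixes T :: "'a::complex_hilbert_space bounded_op"
  shows "pos_def T \<longleftrightarrow> (\<exists>e>0. e *\<^sub>R 1 \<le> T)"
proof
  assume T: "pos_def T"
  hence T0: "0 \<le> T" and inv: "op_invertible T" by (auto simp: pos_def_def)
  have h: "hermitian T" by (rule hermitian_if_nonneg[OF T0])
  \<comment> \<open>The summand 1 only keeps the constant positive.\<close>
  define k where "k = ((norm (op_inv T))\<^sup>2 + 1) * (norm T + 1)"
  have k: "k > 0" unfolding k_def
    by (intro mult_pos_pos) (auto intro: add_nonneg_pos)
  have "(1/k) *\<^sub>R 1 \<le> T"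
  proof (rule op_leI)
    fix x
    have "T \<le> (norm T + 1) *\<^sub>R 1"
      using hermitian_le_norm[OF h] nonneg_one[where 'a='a]
      by (simp add: scaleR_add_left add_increasing2)
    hence "T * T \<le> (norm T + 1) *\<^sub>R T"
      by (intro square_le_scaleR T0) auto
    hence 1: "(norm (op_apply T x))\<^sup>2 \<le> (norm T + 1) * qform T x"
      using qform_mono[of "T * T" _ x] qform_square[OF h, of x] by (metis qform_scaleR)
    have "x = op_apply (op_inv T) (op_apply T x)"
      using op_inv_left[OF inv] by (metis op_apply_times op_apply_one)
    hence "norm x \<le> norm (op_inv T) * norm (op_apply T x)"
      by (metis norm_op_apply)
    hence "(norm x)\<^sup>2 \<le> (norm (op_inv T))\<^sup>2 * (norm (op_apply T x))\<^sup>2"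
      by (metis norm_ge_zero power_mono power_mult_distrib)
    also have "\<dots> \<le> ((norm (op_inv T))\<^sup>2 + 1) * ((norm T + 1) * qform T x)"
      by (intro mult_mono 1) auto
    finally have "(norm x)\<^sup>2 \<le> k * qform T x" by (simp add: k_def mult.assoc)
    thus "qform ((1/k) *\<^sub>R 1) x \<le> qform T x"
      using k by (simp add: field_simps)
  qed (use h in \<open>auto intro: hermitian_intros\<close>)
  thus "\<exists>e>0. e *\<^sub>R 1 \<le> T" using k by (intro exI[of _ "1/k"]) auto
next
  assume "\<exists>e>0. e *\<^sub>R 1 \<le> T"
  then obtain e where e: "e > 0" "e *\<^sub>R 1 \<le> T" by blast
  have "0 \<le> e *\<^sub>R (1::'a bounded_op)"
    using e by (intro scaleR_nonneg_nonneg nonneg_one) auto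
  hence T0: "0 \<le> T" using e(2) by (rule order_trans)
  \<comment> \<open>Rescaled so that \<open>T / c\<close> lies within distance \<open>1 - e / c < 1\<close> of the identity.\<close>
  define c where "c = norm T + e"
  have c: "c > 0" using e by (simp add: c_def add_nonneg_pos)
  have Tc: "T \<le> c *\<^sub>R 1"
    using hermitian_le_norm[OF hermitian_if_nonneg[OF T0]] \<open>0 \<le> e *\<^sub>R 1\<close>
    by (simp add: c_def scaleR_add_left add_increasing2)
  have "norm (1 - (1/c) *\<^sub>R T) \<le> 1 - e / c"
  proof (rule norm_le_if_nonneg)
    have "(1/c) *\<^sub>R T \<le> (1/c) *\<^sub>R (c *\<^sub>R 1)"
      using Tc c by (intro scaleR_left_mono) auto
    thus "0 \<le> 1 - (1/c) *\<^sub>R T" using c by simp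
    have "(1/c) *\<^sub>R (e *\<^sub>R 1) \<le> (1/c) *\<^sub>R T"
      using e c by (intro scaleR_left_mono) auto
    thus "1 - (1/c) *\<^sub>R T \<le> (1 - e / c) *\<^sub>R 1" by (simp add: scaleR_diff_left)
    show "0 \<le> 1 - e / c" using c by (simp add: c_def field_simps)
  qed
  also have "\<dots> < 1" using e c by simp
  finally have "op_invertible (c *\<^sub>R (1 - (1 - (1/c) *\<^sub>R T)))"
    using c by (intro op_invertible_scaleR op_invertible_one_minus) auto
  thus "pos_def T" using T0 c by (simp add: pos_def_def)
qed

lemma pos_def_nonneg: "pos_def T \<Longrightarrow> 0 \<le> T"
  and pos_def_invertible: "pos_def T \<Longrightarrow> op_invertible T"
  by (auto simp: pos_def_def)

lemma pos_def_hermitian: "pos_def T \<Longrightarrow> hermitian T"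
  by (simp add: hermitian_if_nonneg pos_def_nonneg)

lemma pos_def_mono: "pos_def S \<Longrightarrow> S \<le> T \<Longrightarrow> pos_def T"
  unfolding pos_def_iff_bounded_below by (meson order_trans)

lemma pos_def_scaleR: "pos_def T \<Longrightarrow> 0 < c \<Longrightarrow> pos_def (c *\<^sub>R T)"
  by (simp add: pos_def_def op_invertible_scaleR scaleR_nonneg_nonneg)

lemma hermitian_op_inv:
  assumes "hermitian T" and "op_invertible T"
  shows "hermitian (op_inv T)"
  unfolding hermitian_def
proof safe
  fix x y
  have id: "op_apply T (op_apply (op_inv T) z) = z" for z
    using op_inv_right[OF assms(2)] by (metis op_apply_times op_apply_one)
  have "cinner (op_apply (op_inv T) x) (op_apply T (op_apply (op_inv T) y))
      = cinner (op_apply T (op_apply (op_inv T) x)) (op_apply (op_inv T) y)"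
    using assms(1) unfolding hermitian_def by metis
  thus "cinner (op_apply (op_inv T) x) y = cinner x (op_apply (op_inv T) y)"
    by (simp add: id)
qed

lemma op_invertible_op_inv: "op_invertible T \<Longrightarrow> op_invertible (op_inv T)"
  by (rule op_invertibleI[of T]) (auto simp: op_inv_left op_inv_right)

lemma pos_def_congruence:
  assumes "hermitian C" and "op_invertible C" and "pos_def T"
  shows "pos_def (C * T * C)"
  using congruence_mono[OF assms(1) pos_def_nonneg[OF assms(3)]] assms
  by (simp add: pos_def_def op_invertible_mult)

lemma pos_def_op_inv:
  assumes "pos_def T"
  shows "pos_def (op_inv T)"
proof -
  have T: "hermitian T" "op_invertible T"
    using assms by (auto intro: pos_def_hermitian pos_def_invertible)
  have "pos_def (op_inv T * T * op_inv T)"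
    by (intro pos_def_congruence hermitian_op_inv op_invertible_op_inv T assms)
  thus ?thesis using T by (simp add: op_inv_left)
qed

section \<open>Square roots\<close>

text \<open>After rescaling, \<open>T = 1 - X\<close> with \<open>\<parallel>X\<parallel> < 1\<close>, and \<open>1 - Y\<close> is a square root of it exactly
  when \<open>Y = (X + Y\<^sup>2) / 2\<close>; the right-hand side is a contraction of a small ball.\<close>

lemma pos_def_sqrt_exists:
  fixes T :: "'a::complex_hilbert_space bounded_op"
  assumes "pos_def T"
  obtains S where "pos_def S" "S * S = T"
proof -
  obtain e where e: "e > 0" "e *\<^sub>R 1 \<le> T"
    using assms by (auto simp: pos_def_iff_bounded_below)
  have e1: "0 \<le> e *\<^sub>R (1::'a bounded_op)"
    using e by (intro scaleR_nonneg_nonneg nonneg_one) auto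
  define c where "c = norm T + e"
  have c: "c > 0" using e by (simp add: c_def add_nonneg_pos)
  have Tc: "T \<le> c *\<^sub>R 1"
    using hermitian_le_norm[OF pos_def_hermitian[OF assms]] e1
    by (simp add: c_def scaleR_add_left add_increasing2)
  define X where "X = 1 - (1/c) *\<^sub>R T"
  define p where "p = 1 - e / c"
  have p: "0 \<le> p" "p < 1" using c e by (simp_all add: p_def c_def field_simps)
  have hX: "hermitian X"
    unfolding X_def by (intro hermitian_intros pos_def_hermitian assms)
  have nX: "norm X \<le> p"
  proof (rule norm_le_if_nonneg)
    have "(1/c) *\<^sub>R T \<le> (1/c) *\<^sub>R (c *\<^sub>R 1)"
      using Tc c by (intro scaleR_left_mono) auto
    thus "0 \<le> X" using c by (simp add: X_def)
    have "(1/c) *\<^sub>R (e *\<^sub>R 1) \<le> (1/c) *\<^sub>R T"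
      using e c by (intro scaleR_left_mono) auto
    thus "X \<le> p *\<^sub>R 1" by (simp add: X_def p_def scaleR_diff_left)
  qed (rule p)
  define q where "q = (1 + p) / 2"
  have q: "0 < q" "q < 1" using p by (auto simp: q_def)
  have pq: "p + q * q \<le> 2 * q"
  proof -
    have "q * q \<le> 1 * 1" using q by (intro mult_mono) auto
    moreover have "2 * q = 1 + p" by (simp add: q_def)
    ultimately show ?thesis by simp
  qed
  define B where "B = {Y :: 'a bounded_op. norm Y \<le> q \<and> hermitian Y}"
  define f where "f Y = (1/2) *\<^sub>R (X + Y * Y)" for Y
  have "\<exists>!Y\<in>B. f Y = Y"
  proof (rule Banach_fix[of B q f])
    have "closed B"
      unfolding closed_sequential_limits
    proof safe
      fix Y L assume Y: "\<forall>n. Y n \<in> B" "Y \<longlonglongrightarrow> L"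
      have "norm L \<le> q"
        using Y by (intro tendsto_upperbound[OF tendsto_norm[OF Y(2)]]) (auto simp: B_def)
      \<comment> \<open>Self-adjointness passes to the limit because in the ball of radius \<open>q\<close> it amounts to
        the closed condition of lying above \<open>- q\<close>.\<close>
      moreover have "- (q *\<^sub>R 1) \<le> L"
      proof (rule op_le_tendsto[of "\<lambda>_. - (q *\<^sub>R 1)" _ Y])
        fix n
        have "hermitian (Y n)" "norm (Y n) \<le> q" using Y by (auto simp: B_def)
        have "norm (Y n) *\<^sub>R 1 \<le> q *\<^sub>R (1::'a bounded_op)"
          using \<open>norm (Y n) \<le> q\<close> nonneg_one by (rule scaleR_right_mono)
        hence "- (q *\<^sub>R (1::'a bounded_op)) \<le> - (norm (Y n) *\<^sub>R 1)"
          by (rule le_imp_neg_le)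
        also have "\<dots> \<le> Y n"
          by (rule hermitian_ge_minus_norm) fact
        finally show "- (q *\<^sub>R 1) \<le> Y n" .
      qed (use Y in auto)
      from add_right_mono[OF this, of "q *\<^sub>R 1"] have "0 \<le> L + q *\<^sub>R 1" by simp
      hence "hermitian (L + q *\<^sub>R 1 - q *\<^sub>R 1)"
        by (intro hermitian_intros hermitian_if_nonneg)
      ultimately show "L \<in> B" by (simp add: B_def)
    qed
    thus "complete B" by (simp add: complete_eq_closed)
    have "0 \<in> B" using q by (simp add: B_def)
    thus "B \<noteq> {}" by blast
    show "0 \<le> q" "q < 1" using q by auto
    show "f ` B \<subseteq> B"
    proof (intro image_subsetI)
      fix Y assume Y: "Y \<in> B"
      have Y': "norm Y \<le> q" "hermitian Y" using Y by (auto simp: B_def)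
      have "norm (X + Y * Y) \<le> norm X + norm (Y * Y)" by (rule norm_triangle_ineq)
      moreover have "norm (Y * Y) \<le> norm Y * norm Y" by (rule norm_mult_ineq)
      moreover have "norm Y * norm Y \<le> q * q" using Y' q by (intro mult_mono) auto
      ultimately have "norm (X + Y * Y) \<le> 2 * q" using nX pq by linarith
      hence "norm (f Y) \<le> q" by (simp add: f_def)
      moreover have "hermitian (f Y)" unfolding f_def by (intro hermitian_intros hX Y')
      ultimately show "f Y \<in> B" by (simp add: B_def)
    qed
    fix Y Z assume YZ: "Y \<in> B" "Z \<in> B"
    have "f Y - f Z = (1/2) *\<^sub>R (Y * (Y - Z) + (Y - Z) * Z)"
      by (simp add: f_def algebra_simps)
    hence "2 * dist (f Y) (f Z) = norm (Y * (Y - Z) + (Y - Z) * Z)"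
      by (simp add: dist_norm)
    also have "\<dots> \<le> norm (Y * (Y - Z)) + norm ((Y - Z) * Z)"
      by (rule norm_triangle_ineq)
    also have "\<dots> \<le> norm Y * norm (Y - Z) + norm (Y - Z) * norm Z"
      by (intro add_mono norm_mult_ineq)
    also have "\<dots> \<le> q * norm (Y - Z) + norm (Y - Z) * q"
      using YZ q by (intro add_mono mult_mono) (auto simp: B_def)
    finally show "dist (f Y) (f Z) \<le> q * dist Y Z"
      by (simp add: dist_norm)
  qed
  then obtain Y where Y: "norm Y \<le> q" "hermitian Y" "f Y = Y" by (auto simp: B_def)
  have "(1 - Y) * (1 - Y) = 1 - 2 *\<^sub>R Y + Y * Y"
    by (simp add: algebra_simps scaleR_2)
  also have "2 *\<^sub>R Y = 2 *\<^sub>R f Y" using Y(3) by simp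
  also have "\<dots> = X + Y * Y" by (simp add: f_def)
  finally have YY: "(1 - Y) * (1 - Y) = (1/c) *\<^sub>R T" by (simp add: X_def)
  have "Y \<le> q *\<^sub>R 1"
    by (rule order_trans[OF hermitian_le_norm[OF Y(2)] scaleR_right_mono[OF Y(1) nonneg_one]])
  hence "(1 - q) *\<^sub>R 1 \<le> 1 - Y" by (simp add: scaleR_diff_left)
  moreover have "0 < 1 - q" using q by simp
  ultimately have "pos_def (1 - Y)" unfolding pos_def_iff_bounded_below by blast
  show thesis
  proof (rule that)
    show "pos_def (sqrt c *\<^sub>R (1 - Y))"
      using c by (intro pos_def_scaleR \<open>pos_def (1 - Y)\<close>) auto
    show "(sqrt c *\<^sub>R (1 - Y)) * (sqrt c *\<^sub>R (1 - Y)) = T"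
      using c by (simp add: YY)
  qed
qed

text \<open>The square root is operator monotone. Let \<open>c \<ge> 0\<close> be the least number with \<open>P \<le> Q + c\<close>, and
  put \<open>E = Q - P + c \<ge> 0\<close>. If \<open>c > 0\<close>, then \<open>Q E + E Q\<close> is bounded below by
  \<open>2 c Q\<close>, so \<open>E\<close> is bounded below by Cauchy-Schwarz, and \<open>c\<close> was not the least.\<close>

lemma le_if_square_le:
  fixes P Q :: "'a::complex_hilbert_space bounded_op"
  assumes P: "hermitian P" and Q: "pos_def Q" and le: "P * P \<le> Q * Q"
  shows "P \<le> Q"
proof -
  have hQ: "hermitian Q" using Q by (rule pos_def_hermitian)
  obtain c where c: "0 \<le> c" "P - Q \<le> c *\<^sub>R 1"
    and c_min: "\<And>d. 0 \<le> d \<Longrightarrow> P - Q \<le> d *\<^sub>R 1 \<Longrightarrow> c \<le> d"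
    using least_multiple[OF norm_ge_zero hermitian_le_norm[OF hermitian_diff[OF P hQ]]] by blast
  have "c = 0"
  proof (rule ccontr)
    assume "c \<noteq> 0"
    hence c0: "c > 0" using c by simp
    obtain e where e: "e > 0" "e *\<^sub>R 1 \<le> Q"
      using Q by (auto simp: pos_def_iff_bounded_below)
    define E where "E = Q - P + c *\<^sub>R 1"
    have E0: "0 \<le> E" using c(2) by (simp add: E_def algebra_simps)
    have hE: "hermitian E" by (rule hermitian_if_nonneg[OF E0])
    have pos: "0 < norm Q + 1" "0 < norm E + 1"
      using norm_ge_zero[of Q] norm_ge_zero[of E] by linarith+
    define k where "k = c * e / (norm Q + 1)"
    have k: "k > 0" using c0 e pos by (simp add: k_def)
    define d where "d = k\<^sup>2 / (norm E + 1)"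
    have d: "d > 0" using k pos by (simp add: d_def)
    have "d *\<^sub>R 1 \<le> E"
    proof (rule op_leI)
      fix x
      define u where "u = op_apply E x"
      have "P = Q + c *\<^sub>R 1 - E" by (simp add: E_def)
      hence "op_apply P x = op_apply Q x + c *\<^sub>R x - u" by (simp add: u_def)
      hence "(norm (op_apply Q x + (c *\<^sub>R x - u)))\<^sup>2 \<le> (norm (op_apply Q x))\<^sup>2"
        using qform_mono[OF le, of x] by (simp add: qform_square P hQ add_diff_eq)
      hence "2 * (c * Re (cinner (op_apply Q x) x)) + (norm (c *\<^sub>R x - u))\<^sup>2
          \<le> 2 * Re (cinner (op_apply Q x) u)"
        unfolding power2_norm_add by (simp add: cinner_diff_right cinner_scaleR_right)
      hence "c * Re (cinner (op_apply Q x) x) \<le> Re (cinner (op_apply Q x) u)"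
        using zero_le_power2[of "norm (c *\<^sub>R x - u)"] by linarith
      moreover have "e * (norm x)\<^sup>2 \<le> Re (cinner (op_apply Q x) x)"
      proof -
        have "e * (norm x)\<^sup>2 \<le> qform Q x" using qform_mono[OF e(2), of x] by simp
        thus ?thesis by (simp add: qform_def Re_cinner_commute)
      qed
      hence "c * (e * (norm x)\<^sup>2) \<le> c * Re (cinner (op_apply Q x) x)"
        using c0 by (intro mult_left_mono) auto
      moreover have "Re (cinner (op_apply Q x) u) \<le> norm (op_apply Q x) * norm u"
        by (rule Re_cinner_le_norm)
      moreover have "norm (op_apply Q x) * norm u \<le> ((norm Q + 1) * norm x) * norm u"
        using order_trans[OF norm_op_apply[of Q x], of "(norm Q + 1) * norm x"]
        by (intro mult_right_mono) (auto simp: distrib_right)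
      ultimately have "c * e * (norm x)\<^sup>2 \<le> (norm Q + 1) * norm x * norm u" by simp
      hence "norm x * (c * e * norm x) \<le> norm x * ((norm Q + 1) * norm u)"
        by (simp add: power2_eq_square algebra_simps)
      hence "c * e * norm x \<le> (norm Q + 1) * norm u"
        by (cases "x = 0") (auto simp: mult_le_cancel_left_pos)
      hence "k * norm x \<le> norm u"
        using pos by (simp add: k_def pos_divide_le_eq mult.commute)
      hence "(k * norm x)\<^sup>2 \<le> (norm u)\<^sup>2" using k by (intro power_mono) auto
      moreover have "E * E \<le> (norm E + 1) *\<^sub>R E"
      proof (rule square_le_scaleR[OF E0])
        show "E \<le> (norm E + 1) *\<^sub>R 1"
          using hermitian_le_norm[OF hE] nonneg_one[where 'a='a]
          by (simp add: scaleR_add_left add_increasing2)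
      qed auto
      hence "(norm u)\<^sup>2 \<le> (norm E + 1) * qform E x"
        using qform_mono[of "E * E" "(norm E + 1) *\<^sub>R E" x] qform_square[OF hE, of x]
        by (simp add: u_def)
      ultimately have "k\<^sup>2 * (norm x)\<^sup>2 \<le> (norm E + 1) * qform E x"
        by (simp add: power_mult_distrib)
      thus "qform (d *\<^sub>R 1) x \<le> qform E x"
        using pos by (simp add: d_def pos_divide_le_eq mult.commute)
    qed (use hE in \<open>auto intro: hermitian_intros\<close>)
    hence dE: "P - Q \<le> (c - d) *\<^sub>R 1" by (simp add: E_def algebra_simps)
    define b where "b = max 0 (c - d)"
    have "(c - d) *\<^sub>R 1 \<le> b *\<^sub>R (1::'a bounded_op)"
      by (intro scaleR_right_mono nonneg_one) (simp add: b_def)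
    with dE have "c \<le> b" by (intro c_min) (auto simp: b_def)
    thus False using c0 d by (auto simp: b_def)
  qed
  thus ?thesis using c(2) by simp
qed

lemma op_invertible_if_square:
  assumes "op_invertible (S * S)"
  shows "op_invertible S"
proof -
  define J where "J = op_inv (S * S)"
  have J: "J * S * S = 1" "S * (S * J) = 1"
    using op_inv_left[OF assms] op_inv_right[OF assms] by (simp_all add: J_def mult.assoc)
  have "J * S = J * S * (S * (S * J))" by (simp add: J)
  also have "\<dots> = J * S * S * (S * J)" by (simp only: mult.assoc)
  also have "\<dots> = S * J" by (simp add: J)
  finally have "J * S = S * J" .
  hence "S * (J * S) = 1" using J(2) by (simp only:)
  with J(1) show ?thesis by (rule op_invertibleI)
qed

lemma op_sqrt_eqI:
  assumes "pos_def S" and "S * S = T"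
  shows "op_sqrt T = S"
  unfolding op_sqrt_def
proof (rule the_equality)
  fix S' assume S': "0 \<le> S' \<and> S' * S' = T"
  have "op_invertible (S * S)"
    using pos_def_invertible[OF assms(1)] by (intro op_invertible_mult)
  hence "op_invertible (S' * S')" using S' assms(2) by simp
  hence "op_invertible S'" by (rule op_invertible_if_square)
  hence S'_pd: "pos_def S'" using S' by (simp add: pos_def_def)
  show "S' = S"
  proof (rule order_antisym)
    show "S' \<le> S"
      using S' assms(2) by (intro le_if_square_le[OF pos_def_hermitian[OF S'_pd] assms(1)]) simp
    show "S \<le> S'"
      using S' assms(2) by (intro le_if_square_le[OF pos_def_hermitian[OF assms(1)] S'_pd]) simp
  qed
next
  show "0 \<le> S \<and> S * S = T" using pos_def_nonneg[OF assms(1)] assms(2) by blast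
qed

lemma
  assumes "pos_def T"
  shows pos_def_op_sqrt: "pos_def (op_sqrt T)"
    and op_sqrt_square: "op_sqrt T * op_sqrt T = T"
proof -
  obtain S where S: "pos_def S" "S * S = T" using pos_def_sqrt_exists[OF assms] .
  moreover have "op_sqrt T = S" using S by (rule op_sqrt_eqI)
  ultimately show "pos_def (op_sqrt T)" "op_sqrt T * op_sqrt T = T" by simp_all
qed

section \<open>The geometric mean of two operators\<close>

lemma geo_mean2_factorization:
  assumes "pos_def A" and "pos_def B"
  obtains a i c where "hermitian a" "op_invertible a" "hermitian i" "op_invertible i"
    "a * i = 1" "i * a = 1" "A = a * a" "op_inv A = i * i"
    "pos_def c" "c * c = i * B * i" "A \<sharp> B = a * c * a"
proof -
  define a where "a = op_sqrt A"
  define i where "i = op_inv a"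
  define c where "c = op_sqrt (i * B * i)"
  have a: "pos_def a" "a * a = A"
    using assms(1) by (auto simp: a_def pos_def_op_sqrt op_sqrt_square)
  have i: "pos_def i" using a(1) by (simp add: i_def pos_def_op_inv)
  have ai: "a * i = 1" "i * a = 1"
    using a(1) by (auto simp: i_def op_inv_left op_inv_right pos_def_invertible)
  have "i * i * A = i * (i * a) * a" "A * (i * i) = a * (a * i) * i"
    unfolding a(2)[symmetric] by (simp_all only: mult.assoc)
  hence "op_inv A = i * i" using ai by (intro op_inv_eqI) simp_all
  moreover note pos_def_congruence[OF pos_def_hermitian[OF i] pos_def_invertible[OF i] assms(2)]
  hence "pos_def c" "c * c = i * B * i"
    by (auto simp: c_def pos_def_op_sqrt op_sqrt_square)
  moreover have "A \<sharp> B = a * c * a"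
    by (simp add: geo_mean2_def a_def i_def c_def)
  ultimately show thesis
    using a i ai by (intro that[of a i c] pos_def_hermitian pos_def_invertible) simp_all
qed

lemma pos_def_geo_mean2:
  assumes "pos_def A" and "pos_def B"
  shows "pos_def (A \<sharp> B)"
proof -
  obtain a i c where "hermitian a" "op_invertible a" "pos_def c" "A \<sharp> B = a * c * a"
    by (rule geo_mean2_factorization[OF assms])
  thus ?thesis by (simp add: pos_def_congruence)
qed

text \<open>The mean solves the Riccati equation \<open>X A\<inverse> X = B\<close>, it is the only positive
  definite solution, and it dominates all subsolutions. Symmetry and monotonicity, which the
  defining formula hides, are read off from this.\<close>

lemma geo_mean2_riccati:
  assumes "pos_def A" and "pos_def B"
  shows "(A \<sharp> B) * op_inv A * (A \<sharp> B) = B"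
proof -
  obtain a i c where ai: "a * i = 1" "i * a = 1" and Ai: "op_inv A = i * i"
    and c: "c * c = i * B * i" and m: "A \<sharp> B = a * c * a"
    by (rule geo_mean2_factorization[OF assms])
  have "(A \<sharp> B) * op_inv A * (A \<sharp> B) = a * c * (a * i) * (i * a) * c * a"
    by (simp only: m Ai mult.assoc)
  also have "\<dots> = a * (c * c) * a" by (simp add: ai mult.assoc)
  also have "\<dots> = (a * i) * B * (i * a)" by (simp only: c mult.assoc)
  finally show ?thesis by (simp add: ai)
qed

lemma le_geo_mean2I:
  assumes "pos_def A" and "pos_def B" and "hermitian Y" and "Y * op_inv A * Y \<le> B"
  shows "Y \<le> A \<sharp> B"
proof -
  obtain a i c where a: "hermitian a" and i: "hermitian i"
    and ai: "a * i = 1" "i * a = 1" and Ai: "op_inv A = i * i"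
    and c: "pos_def c" "c * c = i * B * i" and m: "A \<sharp> B = a * c * a"
    by (rule geo_mean2_factorization[OF assms(1,2)])
  have "(i * Y * i) * (i * Y * i) = i * (Y * op_inv A * Y) * i"
    by (simp only: Ai mult.assoc)
  also have "\<dots> \<le> c * c"
    unfolding c(2) by (rule congruence_mono[OF i assms(4)])
  finally have sq: "(i * Y * i) * (i * Y * i) \<le> c * c" .
  have "hermitian (i * Y * i)" using i assms(3) by (simp add: hermitian_def)
  hence "i * Y * i \<le> c" using c(1) sq by (rule le_if_square_le)
  from congruence_mono[OF a this]
  have "(a * i) * Y * (i * a) \<le> A \<sharp> B" by (simp only: m mult.assoc)
  thus ?thesis by (simp add: ai)
qed

lemma geo_mean2_eqI:
  assumes "pos_def A" and "pos_def B" and "pos_def Y" and "Y * op_inv A * Y = B"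
  shows "A \<sharp> B = Y"
proof -
  obtain a i c where i: "hermitian i" "op_invertible i"
    and ai: "a * i = 1" "i * a = 1" and Ai: "op_inv A = i * i"
    and c: "pos_def c" "c * c = i * B * i" and m: "A \<sharp> B = a * c * a"
    by (rule geo_mean2_factorization[OF assms(1,2)])
  have "(i * Y * i) * (i * Y * i) = i * (Y * op_inv A * Y) * i"
    by (simp only: Ai mult.assoc)
  hence "(i * Y * i) * (i * Y * i) = c * c" by (simp only: assms(4) c(2))
  moreover have "pos_def (i * Y * i)" by (rule pos_def_congruence[OF i assms(3)])
  ultimately have "op_sqrt (c * c) = i * Y * i" by (intro op_sqrt_eqI)
  moreover have "op_sqrt (c * c) = c" by (rule op_sqrt_eqI[OF c(1) refl])
  ultimately have "c = i * Y * i" by simp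
  hence "A \<sharp> B = (a * i) * Y * (i * a)" by (simp only: m mult.assoc)
  thus ?thesis by (simp add: ai)
qed

lemma geo_mean2_commute:
  assumes "pos_def A" and "pos_def B"
  shows "A \<sharp> B = B \<sharp> A"
proof -
  define X where "X = A \<sharp> B"
  have X: "pos_def X" using assms by (simp add: X_def pos_def_geo_mean2)
  have B: "B = X * op_inv A * X" using geo_mean2_riccati[OF assms] by (simp add: X_def)
  define x where "x = op_inv X"
  have x: "x * X = 1" "X * x = 1"
    using X by (simp_all add: x_def op_inv_left op_inv_right pos_def_invertible)
  have A: "op_inv A * A = 1" "A * op_inv A = 1"
    using assms by (simp_all add: op_inv_left op_inv_right pos_def_invertible)
  have "op_inv B = x * A * x"
  proof (rule op_inv_eqI)
    have "x * A * x * B = x * A * (x * X) * op_inv A * X"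
      by (simp only: B mult.assoc)
    also have "\<dots> = x * (A * op_inv A) * X" by (simp add: x mult.assoc)
    finally show "x * A * x * B = 1" by (simp add: A x)
    have "B * (x * A * x) = X * op_inv A * (X * x) * A * x"
      by (simp only: B mult.assoc)
    also have "\<dots> = X * (op_inv A * A) * x" by (simp add: x mult.assoc)
    finally show "B * (x * A * x) = 1" by (simp add: A x)
  qed
  hence "X * op_inv B * X = (X * x) * A * (x * X)" by (simp only: mult.assoc)
  hence "X * op_inv B * X = A" by (simp add: x)
  hence "B \<sharp> A = X" by (rule geo_mean2_eqI[OF assms(2,1) X])
  thus ?thesis by (simp add: X_def)
qed

lemma geo_mean2_scaleR:
  assumes "pos_def A" and "pos_def B" and "0 < s" and "0 < t"
  shows "(s *\<^sub>R A) \<sharp> (t *\<^sub>R B) = sqrt (s * t) *\<^sub>R (A \<sharp> B)"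
proof (rule geo_mean2_eqI)
  have "op_inv (s *\<^sub>R A) = (1/s) *\<^sub>R op_inv A"
    using assms by (intro op_inv_eqI) (auto simp: op_inv_left op_inv_right pos_def_invertible)
  moreover have "sqrt (s * t) * (1 / s) * sqrt (s * t) = t"
    using assms real_sqrt_mult_self[of "s * t"] by (simp add: field_simps)
  ultimately show "sqrt (s * t) *\<^sub>R (A \<sharp> B) * op_inv (s *\<^sub>R A) * sqrt (s * t) *\<^sub>R (A \<sharp> B) = t *\<^sub>R B"
    using geo_mean2_riccati[OF assms(1,2)] assms by simp
qed (use assms in \<open>auto intro!: pos_def_scaleR pos_def_geo_mean2\<close>)

lemma geo_mean2_mono_right:
  assumes "pos_def A" and "pos_def B" and "B \<le> B'"
  shows "A \<sharp> B \<le> A \<sharp> B'"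
  using assms geo_mean2_riccati[OF assms(1,2)]
  by (intro le_geo_mean2I pos_def_mono[OF assms(2,3)] pos_def_hermitian pos_def_geo_mean2) simp_all

lemma geo_mean2_mono:
  assumes "pos_def A" and "pos_def B" and "A \<le> A'" and "B \<le> B'"
  shows "A \<sharp> B \<le> A' \<sharp> B'"
proof -
  have pd: "pos_def A'" "pos_def B'" using assms pos_def_mono by blast+
  have "A \<sharp> B \<le> A \<sharp> B'" by (rule geo_mean2_mono_right[OF assms(1,2,4)])
  also have "\<dots> = B' \<sharp> A" by (rule geo_mean2_commute[OF assms(1) pd(2)])
  also have "\<dots> \<le> B' \<sharp> A'" by (rule geo_mean2_mono_right[OF pd(2) assms(1,3)])
  also have "\<dots> = A' \<sharp> B'" by (rule geo_mean2_commute[OF pd(2,1)])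
  finally show ?thesis .
qed

lemma geo_mean2_le_arith_mean:
  assumes "pos_def A" and "pos_def B"
  shows "2 *\<^sub>R (A \<sharp> B) \<le> A + B"
proof -
  obtain a i c where a: "hermitian a" and ai: "a * i = 1" "i * a = 1" and A: "A = a * a"
    and c: "pos_def c" "c * c = i * B * i" and m: "A \<sharp> B = a * c * a"
    by (rule geo_mean2_factorization[OF assms])
  have "(c - 1) * (c - 1) = c * c + 1 - 2 *\<^sub>R c" by (simp add: algebra_simps scaleR_2)
  moreover have "0 \<le> (c - 1) * (c - 1)"
    by (intro square_nonneg hermitian_diff pos_def_hermitian c hermitian_one)
  ultimately have "2 *\<^sub>R c \<le> c * c + 1" by simp
  from congruence_mono[OF a this]
  have "2 *\<^sub>R (A \<sharp> B) \<le> (a * i) * B * (i * a) + A"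
    by (simp add: A[symmetric] m c mult.assoc distrib_left distrib_right)
  thus ?thesis by (simp add: ai add.commute)
qed

text \<open>The reverse of the arithmetic-geometric mean inequality. In the factorization above the
  bounds say \<open>exp (- t) \<le> c \<le> exp t\<close>, so that \<open>(c - exp (- t)) (exp t - c) \<ge> 0\<close>; this is
  \<open>c\<^sup>2 + 1 \<le> 2 cosh t c\<close>.\<close>

lemma arith_mean_le_cosh_geo_mean2:
  assumes "pos_def A" and "pos_def B" and "0 \<le> t"
    and AB: "A \<le> exp (2 * t) *\<^sub>R B" and BA: "B \<le> exp (2 * t) *\<^sub>R A"
  shows "A + B \<le> (2 * cosh t) *\<^sub>R (A \<sharp> B)"
proof -
  obtain a i c where a: "hermitian a" and i: "hermitian i"
    and ai: "a * i = 1" "i * a = 1" and A: "A = a * a"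
    and c: "pos_def c" "c * c = i * B * i" and m: "A \<sharp> B = a * c * a"
    by (rule geo_mean2_factorization[OF assms(1,2)])
  have iAi: "i * A * i = 1"
  proof -
    have "i * A * i = (i * a) * (a * i)" by (simp only: A mult.assoc)
    thus ?thesis by (simp add: ai)
  qed
  have e2: "exp (2 * t) = exp t * exp t" by (simp flip: exp_add)
  have pd: "pos_def (r *\<^sub>R 1)" if "0 < r" for r :: real
    unfolding pos_def_iff_bounded_below using that by (intro exI[of _ r]) simp
  have upper: "c \<le> exp t *\<^sub>R 1"
  proof (rule le_if_square_le)
    have "c * c \<le> i * (exp (2 * t) *\<^sub>R A) * i"
      unfolding c(2) by (rule congruence_mono[OF i BA])
    thus "c * c \<le> exp t *\<^sub>R 1 * exp t *\<^sub>R 1" by (simp add: iAi e2)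
  qed (auto intro: pd pos_def_hermitian c hermitian_scaleR)
  have lower: "exp (- t) *\<^sub>R 1 \<le> c"
  proof (rule le_if_square_le)
    have "i * A * i \<le> i * (exp (2 * t) *\<^sub>R B) * i"
      by (rule congruence_mono[OF i AB])
    hence "1 \<le> exp (2 * t) *\<^sub>R (c * c)" by (simp add: iAi c(2))
    hence "exp (- 2 * t) *\<^sub>R 1 \<le> exp (- 2 * t) *\<^sub>R (exp (2 * t) *\<^sub>R (c * c))"
      by (rule scaleR_left_mono) simp
    moreover have "exp (- 2 * t) * exp (2 * t) = 1" by (simp flip: exp_add)
    moreover have "exp (- t) * exp (- t) = exp (- 2 * t)" by (simp flip: exp_add)
    ultimately show "exp (- t) *\<^sub>R 1 * exp (- t) *\<^sub>R 1 \<le> c * c" by simp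
  qed (auto intro: pd pos_def_hermitian c hermitian_scaleR)
  define p where "p = c - exp (- t) *\<^sub>R 1"
  define k where "k = exp t - exp (- t)"
  have "p * p \<le> k *\<^sub>R p"
  proof (rule square_le_scaleR)
    show "0 \<le> p" using lower by (simp add: p_def)
    show "p \<le> k *\<^sub>R 1" using upper by (simp add: p_def k_def scaleR_diff_left)
    show "0 \<le> k" using assms(3) by (simp add: k_def)
  qed
  moreover have "k *\<^sub>R p - p * p = (2 * cosh t) *\<^sub>R c - (c * c + 1)"
  proof -
    have tt: "exp t * exp (- t) = 1" by (simp flip: exp_add)
    have "p * p = c * c - exp (- t) *\<^sub>R c - exp (- t) *\<^sub>R c + (exp (- t) * exp (- t)) *\<^sub>R 1"
      by (simp add: p_def left_diff_distrib right_diff_distrib scaleR_diff_right)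
    moreover have "k *\<^sub>R p = exp t *\<^sub>R c - exp (- t) *\<^sub>R c - 1 + (exp (- t) * exp (- t)) *\<^sub>R 1"
      by (simp add: p_def k_def scaleR_diff_left scaleR_diff_right left_diff_distrib tt)
    moreover have "(2 * cosh t) *\<^sub>R c = exp t *\<^sub>R c + exp (- t) *\<^sub>R c"
      by (simp add: cosh_def flip: scaleR_add_left)
    ultimately show ?thesis by simp
  qed
  ultimately have "c * c + 1 \<le> (2 * cosh t) *\<^sub>R c" by (metis diff_ge_0_iff_ge)
  from congruence_mono[OF a this]
  have "(a * i) * B * (i * a) + A \<le> (2 * cosh t) *\<^sub>R (A \<sharp> B)"
    by (simp add: A[symmetric] m c mult.assoc distrib_left distrib_right)
  thus ?thesis by (simp add: ai add.commute)
qed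

lemma geo_mean2_compare:
  assumes "pos_def A" "pos_def B" "pos_def A'" "pos_def B'"
    and "A \<le> exp k *\<^sub>R A'" and "B \<le> exp l *\<^sub>R B'"
  shows "A \<sharp> B \<le> exp ((k + l) / 2) *\<^sub>R (A' \<sharp> B')"
proof -
  have "sqrt (exp k * exp l) = exp ((k + l) / 2)"
    by (rule real_sqrt_unique) (simp_all add: power2_eq_square flip: exp_add)
  thus ?thesis
    using geo_mean2_mono[OF assms(1,2,5,6)] geo_mean2_scaleR[OF assms(3,4), of "exp k" "exp l"]
    by simp
qed

section \<open>Tuples with one entry omitted\<close>

text \<open>The index in the full tuple of entry \<open>k\<close> of the tuple without \<open>i\<close>.\<close>

definition skip :: "nat \<Rightarrow> nat \<Rightarrow> nat"
  where "skip i k = (if k < i then k else Suc k)"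

lemma omit_eq_skip: "omit i A k = A (skip i k)"
  by (simp add: omit_def skip_def)

lemma bij_betw_skip:
  assumes "i < Suc n"
  shows "bij_betw (skip i) {..<n} ({..<Suc n} - {i})"
proof (rule bij_betw_byWitness[where f' = "\<lambda>j. if j < i then j else j - 1"])
  show "skip i ` {..<n} \<subseteq> {..<Suc n} - {i}"
    using assms by (auto simp: skip_def)
qed (use assms in \<open>auto simp: skip_def\<close>)

lemma skip_less: "k < n \<Longrightarrow> skip i k < Suc n"
  by (simp add: skip_def)

lemma sum_skip:
  fixes f :: "nat \<Rightarrow> 'b::ab_group_add"
  assumes "i < Suc n"
  shows "(\<Sum>k<n. f (skip i k)) = (\<Sum>k<Suc n. f k) - f i"
proof -
  have "(\<Sum>k<n. f (skip i k)) = sum f ({..<Suc n} - {i})"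
    by (rule sum.reindex_bij_betw[OF bij_betw_skip[OF assms]])
  also have "\<dots> = (\<Sum>k<Suc n. f k) - f i"
    using assms by (subst sum_diff1) auto
  finally show ?thesis .
qed

text \<open>A permutation restricts to the complements of \<open>i\<close> and \<open>\<sigma> i\<close>; \<open>\<tau>\<close> is this restriction
  after both complements are renumbered by \<open>{..<n}\<close>.\<close>

lemma permutation_skip:
  assumes \<sigma>: "bij_betw \<sigma> {..<Suc n} {..<Suc n}" and i: "i < Suc n"
  obtains \<tau> where "bij_betw \<tau> {..<n} {..<n}" "\<forall>k<n. skip (\<sigma> i) (\<tau> k) = \<sigma> (skip i k)"
proof -
  have si: "\<sigma> i < Suc n" using \<sigma> i by (auto dest: bij_betwE)
  have "bij_betw \<sigma> ({..<Suc n} - {i}) ({..<Suc n} - {\<sigma> i})"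
    using \<sigma> i by (intro bij_betw_DiffI) (auto simp: bij_betw_def)
  hence 1: "bij_betw (\<sigma> \<circ> skip i) {..<n} ({..<Suc n} - {\<sigma> i})"
    using bij_betw_skip[OF i] by (rule bij_betw_trans[rotated])
  define \<tau> where "\<tau> = inv_into {..<n} (skip (\<sigma> i)) \<circ> (\<sigma> \<circ> skip i)"
  show thesis
  proof (rule that)
    show "bij_betw \<tau> {..<n} {..<n}"
      unfolding \<tau>_def by (rule bij_betw_trans[OF 1 bij_betw_inv_into[OF bij_betw_skip[OF si]]])
    show "\<forall>k<n. skip (\<sigma> i) (\<tau> k) = \<sigma> (skip i k)"
    proof (intro allI impI)
      fix k assume "k < n"
      hence "\<sigma> (skip i k) \<in> {..<Suc n} - {\<sigma> i}" using bij_betwE[OF 1] by auto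
      thus "skip (\<sigma> i) (\<tau> k) = \<sigma> (skip i k)"
        using bij_betw_skip[OF si] by (simp add: \<tau>_def bij_betw_inv_into_right)
    qed
  qed
qed

section \<open>One round of the Ando-Li-Mathias iteration\<close>

text \<open>By the addition theorem, \<open>cosh (s + t) \<ge> cosh s * cosh t\<close> for \<open>s, t \<ge> 0\<close>.\<close>

lemma power_cosh_le: "cosh t ^ k \<le> cosh (real k * t)" if "0 \<le> t"
proof (induction k)
  case (Suc k)
  have "cosh t ^ Suc k \<le> cosh t * cosh (real k * t)"
    using Suc by (simp add: mult_left_mono)
  also have "\<dots> \<le> cosh t * cosh (real k * t) + sinh t * sinh (real k * t)"
    using that by simp
  also have "\<dots> = cosh (real (Suc k) * t)"
    by (simp add: cosh_add distrib_right)
  finally show ?case .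
qed simp

text \<open>A squeezing principle in which the width of the gap is measured by a fixed operator.\<close>

lemma op_squeeze:
  fixes X Y :: "nat \<Rightarrow> 'a::complex_hilbert_space bounded_op"
  assumes "Y \<longlonglongrightarrow> L" and "\<And>r. Y r \<le> X r" and "\<And>r. X r - Y r \<le> c r *\<^sub>R B"
    and "c \<longlonglongrightarrow> 0"
  shows "X \<longlonglongrightarrow> L"
proof -
  have "(\<lambda>r. norm (X r - Y r)) \<longlonglongrightarrow> 0"
  proof (rule tendsto_sandwich[of "\<lambda>_. 0" _ _ "\<lambda>r. \<bar>c r\<bar> * norm B"])
    have "norm (X r - Y r) \<le> \<bar>c r\<bar> * norm B" for r
      using op_norm_mono[of "X r - Y r" "c r *\<^sub>R B"] assms(2,3)[of r] by simp
    thus "\<forall>\<^sub>F r in sequentially. norm (X r - Y r) \<le> \<bar>c r\<bar> * norm B" by simp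
    show "(\<lambda>r. \<bar>c r\<bar> * norm B) \<longlonglongrightarrow> 0"
      using tendsto_mult[OF tendsto_rabs[OF assms(4)] tendsto_const[of "norm B"]] by simp
  qed auto
  hence "(\<lambda>r. X r - Y r) \<longlonglongrightarrow> 0" by (rule tendsto_norm_zero_cancel)
  from tendsto_add[OF this assms(1)] show ?thesis by simp
qed

lemma pos_def_sum:
  fixes A :: "nat \<Rightarrow> 'a::complex_hilbert_space bounded_op"
  assumes "0 < N" and "\<And>i. i < N \<Longrightarrow> pos_def (A i)"
  shows "pos_def (\<Sum>i<N. A i)"
proof (rule pos_def_mono)
  show "pos_def (A 0)" using assms by simp
  have "sum A {0} \<le> sum A {..<N}"
    using assms by (intro sum_mono2) (auto intro: pos_def_nonneg)
  thus "A 0 \<le> (\<Sum>i<N. A i)" by simp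
qed

text \<open>If \<open>e j\<close> is a lower bound of \<open>A j\<close>, then \<open>A i \<le> (\<parallel>A i\<parallel> / e j) A j\<close>.\<close>

lemma tuple_spread_exists:
  fixes A :: "nat \<Rightarrow> 'a::complex_hilbert_space bounded_op"
  assumes "\<And>i. i < N \<Longrightarrow> pos_def (A i)"
  obtains t where "0 \<le> t" "\<And>i j. i < N \<Longrightarrow> j < N \<Longrightarrow> A i \<le> exp (2 * t) *\<^sub>R A j"
proof -
  have "\<exists>e>0. e *\<^sub>R 1 \<le> A i" if "i < N" for i
    using assms[OF that] by (simp add: pos_def_iff_bounded_below)
  then obtain e where e: "\<And>i. i < N \<Longrightarrow> e i > 0 \<and> e i *\<^sub>R 1 \<le> A i" by metis
  define c where "c = 1 + (\<Sum>i<N. \<Sum>j<N. norm (A i) / e j)"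
  have nn: "0 \<le> norm (A i) / e j" if "j < N" for i j
    using e[OF that] by simp
  have "0 \<le> (\<Sum>i<N. \<Sum>j<N. norm (A i) / e j)"
    by (intro sum_nonneg nn) simp
  hence c1: "1 \<le> c" by (simp add: c_def)
  have c_ge: "norm (A i) / e j \<le> c" if "i < N" "j < N" for i j
  proof -
    have "norm (A i) / e j \<le> (\<Sum>j<N. norm (A i) / e j)"
      using that nn by (intro member_le_sum) auto
    also have "\<dots> \<le> (\<Sum>i<N. \<Sum>j<N. norm (A i) / e j)"
      using that nn by (intro member_le_sum[where f = "\<lambda>i. \<Sum>j<N. norm (A i) / e j"]) (auto intro: sum_nonneg)
    finally show ?thesis by (simp add: c_def)
  qed
  show thesis
  proof (rule that)
    show "0 \<le> ln c / 2" using c1 by simp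
    fix i j assume ij: "i < N" "j < N"
    have ej: "e j > 0" "e j *\<^sub>R 1 \<le> A j" using e[OF ij(2)] by auto
    have "A i \<le> norm (A i) *\<^sub>R 1"
      by (rule hermitian_le_norm[OF pos_def_hermitian[OF assms[OF ij(1)]]])
    also have "norm (A i) *\<^sub>R 1 = (norm (A i) / e j) *\<^sub>R (e j *\<^sub>R (1 :: 'a bounded_op))"
      using ej by simp
    also have "\<dots> \<le> (norm (A i) / e j) *\<^sub>R A j"
      using ej by (intro scaleR_left_mono) auto
    also have "\<dots> \<le> c *\<^sub>R A j"
      by (intro scaleR_right_mono c_ge ij pos_def_nonneg assms)
    also have "c = exp (2 * (ln c / 2))" using c1 by simp
    finally show "A i \<le> exp (2 * (ln c / 2)) *\<^sub>R A j" .
  qed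
qed

text \<open>The induction hypothesis on a mean of \<open>n\<close> operators. The comparison principle
  combines monotonicity, homogeneity and invariance under permutations; the last of these is needed
  because omitting different entries shifts the remaining ones to different positions. Ratios are
  written as exponentials, which makes the bounds additive in the exponents.\<close>

locale geometric_mean_bounds =
  fixes n :: nat and G :: "(nat \<Rightarrow> 'a::complex_hilbert_space bounded_op) \<Rightarrow> 'a bounded_op"
  assumes two_le: "2 \<le> n"
    and pos_def_mean: "(\<And>i. i < n \<Longrightarrow> pos_def (A i)) \<Longrightarrow> pos_def (G A)"
    and mean_compare: "(\<And>i. i < n \<Longrightarrow> pos_def (A i)) \<Longrightarrow> (\<And>i. i < n \<Longrightarrow> pos_def (B i))
      \<Longrightarrow> bij_betw \<sigma> {..<n} {..<n} \<Longrightarrow> (\<And>i. i < n \<Longrightarrow> A i \<le> exp (l i) *\<^sub>R B (\<sigma> i))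
      \<Longrightarrow> G A \<le> exp ((\<Sum>i<n. l i) / real n) *\<^sub>R G B"
    and mean_le_sum: "(\<And>i. i < n \<Longrightarrow> pos_def (A i)) \<Longrightarrow> real n *\<^sub>R G A \<le> (\<Sum>i<n. A i)"
    and sum_le_mean: "(\<And>i. i < n \<Longrightarrow> pos_def (A i)) \<Longrightarrow> 0 \<le> t
      \<Longrightarrow> (\<And>i j. i < n \<Longrightarrow> j < n \<Longrightarrow> A i \<le> exp (2 * t) *\<^sub>R A j)
      \<Longrightarrow> (\<Sum>i<n. A i) \<le> (real n * cosh t ^ (n - 1)) *\<^sub>R G A"
begin

abbreviation step :: "(nat \<Rightarrow> 'a bounded_op) \<Rightarrow> nat \<Rightarrow> 'a bounded_op"
  where "step \<equiv> \<lambda>A i. G (omit i A)"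

abbreviation total :: "(nat \<Rightarrow> 'a bounded_op) \<Rightarrow> 'a bounded_op"
  where "total A \<equiv> (\<Sum>i<Suc n. A i)"

lemma pos_def_step:
  assumes "\<And>i. i < Suc n \<Longrightarrow> pos_def (A i)"
  shows "pos_def (step A i)"
  by (intro pos_def_mean) (simp add: omit_eq_skip assms skip_less)

lemma pos_def_iterate:
  assumes "\<And>i. i < Suc n \<Longrightarrow> pos_def (A i)" and "i < Suc n"
  shows "pos_def ((step ^^ r) A i)"
  using assms(2)
proof (induction r arbitrary: i)
  case 0 thus ?case by (simp add: assms(1))
next
  case (Suc r)
  show ?case unfolding funpow.simps o_apply by (rule pos_def_step) (rule Suc.IH)
qed

lemma step_compare:
  assumes A: "\<And>i. i < Suc n \<Longrightarrow> pos_def (A i)" and B: "\<And>i. i < Suc n \<Longrightarrow> pos_def (B i)"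
    and \<sigma>: "bij_betw \<sigma> {..<Suc n} {..<Suc n}"
    and le: "\<And>i. i < Suc n \<Longrightarrow> A i \<le> exp (l i) *\<^sub>R B (\<sigma> i)"
    and i: "i < Suc n"
  shows "step A i \<le> exp (((\<Sum>k<Suc n. l k) - l i) / real n) *\<^sub>R step B (\<sigma> i)"
proof -
  obtain \<tau> where \<tau>: "bij_betw \<tau> {..<n} {..<n}" "\<forall>k<n. skip (\<sigma> i) (\<tau> k) = \<sigma> (skip i k)"
    by (rule permutation_skip[OF \<sigma> i])
  have "step A i \<le> exp ((\<Sum>k<n. l (skip i k)) / real n) *\<^sub>R step B (\<sigma> i)"
    by (rule mean_compare[OF _ _ \<tau>(1)])
       (simp_all add: omit_eq_skip A B le \<tau>(2) skip_less)
  thus ?thesis by (simp only: sum_skip[OF i])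
qed

text \<open>One round maps the exponents \<open>l\<close> to \<open>((\<Sum>k. l k) - l i) / n\<close>. Their mean \<open>\<mu>\<close> over the
  \<open>n + 1\<close> indices is preserved, and the deviation from it is multiplied by \<open>- 1 / n\<close>.\<close>

lemma iterate_compare:
  assumes A: "\<And>i. i < Suc n \<Longrightarrow> pos_def (A i)" and B: "\<And>i. i < Suc n \<Longrightarrow> pos_def (B i)"
    and \<sigma>: "bij_betw \<sigma> {..<Suc n} {..<Suc n}"
    and le: "\<And>i. i < Suc n \<Longrightarrow> A i \<le> exp (l i) *\<^sub>R B (\<sigma> i)"
    and "i < Suc n"
  defines "\<mu> \<equiv> (\<Sum>k<Suc n. l k) / real (Suc n)"
  shows "(step ^^ r) A i \<le> exp (\<mu> + (- 1 / real n) ^ r * (l i - \<mu>)) *\<^sub>R (step ^^ r) B (\<sigma> i)"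
  using \<open>i < Suc n\<close>
proof (induction r arbitrary: i)
  case 0 thus ?case by (simp add: le)
next
  case (Suc r)
  define l' where "l' k = \<mu> + (- 1 / real n) ^ r * (l k - \<mu>)" for k
  have n0: "real n \<noteq> 0" using two_le by simp
  have \<mu>: "(\<Sum>k<Suc n. l k) = real (Suc n) * \<mu>" by (simp add: \<mu>_def)
  have "(\<Sum>k<Suc n. l' k) = real (Suc n) * \<mu> + (- 1 / real n) ^ r * ((\<Sum>k<Suc n. l k) - real (Suc n) * \<mu>)"
    unfolding l'_def by (simp only: sum.distrib sum_subtractf sum_constant card_lessThan flip: sum_distrib_left)
  also have "\<dots> = real (Suc n) * \<mu>" by (simp only: \<mu>) simp
  finally have sum: "(\<Sum>k<Suc n. l' k) = real (Suc n) * \<mu>" .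
  have "step ((step ^^ r) A) i \<le> exp (((\<Sum>k<Suc n. l' k) - l' i) / real n) *\<^sub>R step ((step ^^ r) B) (\<sigma> i)"
    using Suc.IH \<sigma> Suc.prems unfolding l'_def[symmetric]
    by (intro step_compare pos_def_iterate A B) auto
  also have "((\<Sum>k<Suc n. l' k) - l' i) / real n = \<mu> + (- 1 / real n) ^ Suc r * (l i - \<mu>)"
    unfolding sum using n0 by (simp add: l'_def field_simps)
  finally show ?case by simp
qed

text \<open>Exchange the entries \<open>i\<close> and \<open>j\<close>: the tuples with \<open>i\<close> and with \<open>j\<close> omitted differ, up
  to a permutation, in one entry only, which counts with weight \<open>1 / n\<close>.\<close>

lemma step_spread:
  assumes A: "\<And>i. i < Suc n \<Longrightarrow> pos_def (A i)" and t: "0 \<le> t"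
    and le: "\<And>i j. i < Suc n \<Longrightarrow> j < Suc n \<Longrightarrow> A i \<le> exp (2 * t) *\<^sub>R A j"
    and ij: "i < Suc n" "j < Suc n"
  shows "step A i \<le> exp (2 * (t / real n)) *\<^sub>R step A j"
proof (cases "i = j")
  case True
  have "1 *\<^sub>R step A i \<le> exp (2 * (t / real n)) *\<^sub>R step A i"
    using t by (intro scaleR_right_mono pos_def_nonneg pos_def_step A) auto
  thus ?thesis using True by simp
next
  case False
  define l where "l k = (if k \<in> {i, j} then 2 * t else 0)" for k
  have "step A i \<le> exp (((\<Sum>k<Suc n. l k) - l i) / real n) *\<^sub>R step A (Transposition.transpose i j i)"
  proof (rule step_compare[where l = l and \<sigma> = "Transposition.transpose i j"])
    show "bij_betw (Transposition.transpose i j) {..<Suc n} {..<Suc n}"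
      using ij by (intro bij_betw_imageI) (auto simp: Transposition.transpose_def image_iff inj_on_def)
    fix k assume "k < Suc n"
    thus "A k \<le> exp (l k) *\<^sub>R A (Transposition.transpose i j k)"
      using le ij pos_def_nonneg[OF A] by (auto simp: l_def Transposition.transpose_def)
  qed (use ij A in auto)
  moreover have "(\<Sum>k<Suc n. l k) = (\<Sum>k\<in>{i, j}. l k)"
    by (rule sum.mono_neutral_right) (use ij in \<open>auto simp: l_def\<close>)
  ultimately show ?thesis using False by (simp add: l_def)
qed

lemma iterate_spread:
  assumes A: "\<And>i. i < Suc n \<Longrightarrow> pos_def (A i)" and t: "0 \<le> t"
    and le: "\<And>i j. i < Suc n \<Longrightarrow> j < Suc n \<Longrightarrow> A i \<le> exp (2 * t) *\<^sub>R A j"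
    and ij: "i < Suc n" "j < Suc n"
  shows "(step ^^ r) A i \<le> exp (2 * (t / real n ^ r)) *\<^sub>R (step ^^ r) A j"
  using ij
proof (induction r arbitrary: i j)
  case 0 thus ?case by (simp add: le)
next
  case (Suc r)
  have "step ((step ^^ r) A) i \<le> exp (2 * (t / real n ^ r / real n)) *\<^sub>R step ((step ^^ r) A) j"
    using Suc t by (intro step_spread pos_def_iterate A) auto
  thus ?case by (simp add: mult.commute)
qed

text \<open>Each entry occurs in \<open>n\<close> of the \<open>n + 1\<close> tuples with one entry omitted, so summing an
  inequality between mean and sum over these tuples compares the totals before and after a
  round.\<close>

lemma total_step_le:
  assumes A: "\<And>i. i < Suc n \<Longrightarrow> pos_def (A i)"
  shows "total (step A) \<le> total A"
proof -
  have "real n *\<^sub>R step A i \<le> total A - A i" if "i < Suc n" for i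
    using mean_le_sum[of "omit i A"] by (simp only: omit_eq_skip sum_skip[OF that] A skip_less)
  hence "(\<Sum>i<Suc n. real n *\<^sub>R step A i) \<le> (\<Sum>i<Suc n. total A - A i)"
    by (intro sum_mono) auto
  hence "real n *\<^sub>R total (step A) \<le> real (Suc n) *\<^sub>R total A - total A"
    by (simp only: scaleR_sum_right sum_subtractf sum_constant_scaleR card_lessThan)
  also have "\<dots> = real n *\<^sub>R total A" by (simp add: scaleR_add_left del: sum.lessThan_Suc)
  finally have "(1 / real n) *\<^sub>R (real n *\<^sub>R total (step A)) \<le> (1 / real n) *\<^sub>R (real n *\<^sub>R total A)"
    by (rule scaleR_left_mono) simp
  thus ?thesis using two_le by (simp del: sum.lessThan_Suc)
qed

lemma total_le_step:
  assumes A: "\<And>i. i < Suc n \<Longrightarrow> pos_def (A i)" and t: "0 \<le> t"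
    and le: "\<And>i j. i < Suc n \<Longrightarrow> j < Suc n \<Longrightarrow> A i \<le> exp (2 * t) *\<^sub>R A j"
  shows "total A \<le> (cosh t ^ (n - 1)) *\<^sub>R total (step A)"
proof -
  have "total A - A i \<le> (real n * cosh t ^ (n - 1)) *\<^sub>R step A i" if "i < Suc n" for i
    using sum_le_mean[of "omit i A" t] t by (simp only: omit_eq_skip sum_skip[OF that] A le skip_less)
  hence "(\<Sum>i<Suc n. total A - A i) \<le> (\<Sum>i<Suc n. (real n * cosh t ^ (n - 1)) *\<^sub>R step A i)"
    by (intro sum_mono) auto
  hence "real (Suc n) *\<^sub>R total A - total A \<le> (real n * cosh t ^ (n - 1)) *\<^sub>R total (step A)"
    by (simp only: scaleR_sum_right sum_subtractf sum_constant_scaleR card_lessThan)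
  moreover have "real (Suc n) *\<^sub>R total A - total A = real n *\<^sub>R total A"
    by (simp add: scaleR_add_left del: sum.lessThan_Suc)
  ultimately have "real n *\<^sub>R total A \<le> (real n * cosh t ^ (n - 1)) *\<^sub>R total (step A)" by simp
  hence "(1 / real n) *\<^sub>R (real n *\<^sub>R total A)
      \<le> (1 / real n) *\<^sub>R ((real n * cosh t ^ (n - 1)) *\<^sub>R total (step A))"
    by (rule scaleR_left_mono) simp
  thus ?thesis using two_le by (simp del: sum.lessThan_Suc)
qed

end

section \<open>Convergence of the iteration\<close>

context geometric_mean_bounds
begin

lemma total_iterate_le:
  assumes A: "\<And>i. i < Suc n \<Longrightarrow> pos_def (A i)"
  shows "total ((step ^^ r) A) \<le> total A"
proof (induction r)
  case (Suc r)
  have "total (step ((step ^^ r) A)) \<le> total ((step ^^ r) A)"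
    by (intro total_step_le pos_def_iterate A)
  also note Suc
  finally show ?case by (simp only: funpow.simps o_apply)
qed simp

text \<open>The losses of the successive rounds multiply to at most \<open>cosh t ^ n\<close>: after one round \<open>t\<close>
  has become \<open>t / n\<close>, and \<open>cosh (t / n) ^ n \<le> cosh t\<close>.\<close>

lemma total_le_iterate:
  assumes "\<And>i. i < Suc n \<Longrightarrow> pos_def (A i)" and "0 \<le> t"
    and "\<And>i j. i < Suc n \<Longrightarrow> j < Suc n \<Longrightarrow> A i \<le> exp (2 * t) *\<^sub>R A j"
  shows "total A \<le> (cosh t ^ n) *\<^sub>R total ((step ^^ r) A)"
  using assms
proof (induction r arbitrary: A t)
  case 0
  have "1 *\<^sub>R total A \<le> (cosh t ^ n) *\<^sub>R total A"
    using 0 by (intro scaleR_right_mono pos_def_nonneg pos_def_sum one_le_power cosh_real_ge_1) auto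
  thus ?case by (simp del: sum.lessThan_Suc)
next
  case (Suc r)
  have n0: "real n > 0" using two_le by simp
  have "total A \<le> (cosh t ^ (n - 1)) *\<^sub>R total (step A)"
    by (rule total_le_step) (use Suc.prems in auto)
  also have "total (step A) \<le> (cosh (t / real n) ^ n) *\<^sub>R total ((step ^^ r) (step A))"
    using Suc.prems by (intro Suc.IH pos_def_step step_spread) auto
  hence "(cosh t ^ (n - 1)) *\<^sub>R total (step A)
      \<le> (cosh t ^ (n - 1)) *\<^sub>R ((cosh (t / real n) ^ n) *\<^sub>R total ((step ^^ r) (step A)))"
    by (rule scaleR_left_mono) simp
  also have "\<dots> = (cosh t ^ (n - 1) * cosh (t / real n) ^ n) *\<^sub>R total ((step ^^ r) (step A))"
    by (simp del: sum.lessThan_Suc)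
  also have "\<dots> \<le> (cosh t ^ n) *\<^sub>R total ((step ^^ r) (step A))"
  proof (rule scaleR_right_mono)
    have "cosh (t / real n) ^ n \<le> cosh t"
      using power_cosh_le[of "t / real n" n] Suc.prems(2) n0 by simp
    hence "cosh t ^ (n - 1) * cosh (t / real n) ^ n \<le> cosh t ^ (n - 1) * cosh t"
      by (rule mult_left_mono) simp
    also have "\<dots> = cosh t ^ n" using two_le by (simp flip: power_Suc2)
    finally show "cosh t ^ (n - 1) * cosh (t / real n) ^ n \<le> cosh t ^ n" .
    show "0 \<le> total ((step ^^ r) (step A))"
      using Suc.prems(1) by (intro pos_def_nonneg pos_def_sum pos_def_iterate pos_def_step) auto
  qed
  finally show ?case by (simp only: funpow_Suc_right o_apply)
qed

text \<open>The totals decrease, and round \<open>r\<close> loses at most the factor \<open>cosh (t / n ^ r) ^ n\<close> for ever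
  after; this factor tends to 1, so the totals form a Cauchy sequence. The entries of the tuple
  approach each other, hence they all follow the average.\<close>

lemma iterates_converge:
  assumes A: "\<And>i. i < Suc n \<Longrightarrow> pos_def (A i)"
  obtains L where "pos_def L" "\<forall>i<Suc n. (\<lambda>r. (step ^^ r) A i) \<longlonglongrightarrow> L"
    "real (Suc n) *\<^sub>R L \<le> total A"
    "\<forall>t\<ge>0. (\<forall>i<Suc n. \<forall>j<Suc n. A i \<le> exp (2 * t) *\<^sub>R A j)
      \<longrightarrow> total A \<le> (real (Suc n) * cosh t ^ n) *\<^sub>R L"
proof -
  have n1: "1 < real n" using two_le by simp
  obtain t where t: "0 \<le> t" and le: "\<And>i j. i < Suc n \<Longrightarrow> j < Suc n \<Longrightarrow> A i \<le> exp (2 * t) *\<^sub>R A j"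
    using tuple_spread_exists[of "Suc n" A] A by blast
  define X where "X r = (step ^^ r) A" for r
  define S where "S r = total (X r)" for r
  define u where "u r = t / real n ^ r" for r
  have X_pd: "pos_def (X r i)" if "i < Suc n" for r i
    unfolding X_def by (rule pos_def_iterate[OF A that])
  have S_pd: "pos_def (S r)" for r
    unfolding S_def by (rule pos_def_sum) (auto intro: X_pd)
  have S0: "S 0 = total A" by (simp add: S_def X_def)
  have S_le: "S r \<le> S 0" for r
    unfolding S0 unfolding S_def X_def by (rule total_iterate_le[OF A])
  have u0: "0 \<le> u r" for r using t by (simp add: u_def)
  have "(\<lambda>r. t * (1 / real n) ^ r) \<longlonglongrightarrow> t * 0"
    using n1 by (intro tendsto_intros LIMSEQ_power_zero) auto
  hence u_lim: "u \<longlonglongrightarrow> 0" by (simp add: u_def[abs_def] power_divide)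
  have spread: "X r i \<le> exp (2 * u r) *\<^sub>R X r j" if "i < Suc n" "j < Suc n" for r i j
    unfolding X_def u_def by (rule iterate_spread[OF A t le that])
  have X_add: "(step ^^ m) (X r) = X (r + m)" for r m
    unfolding X_def by (simp add: funpow_add add.commute[of r])
  have mono: "S (r + m) \<le> S r" for r m
    using total_iterate_le[of "X r" m] X_pd unfolding S_def X_add by blast
  have loss: "S r \<le> (cosh (u r) ^ n) *\<^sub>R S (r + m)" for r m
    using total_le_iterate[of "X r" "u r" m] X_pd u0 spread unfolding S_def X_add by blast
  have bound: "norm (S r - S (r + m)) \<le> (cosh (u r) ^ n - 1) * norm (S 0)" for r m
  proof -
    have c1: "1 \<le> cosh (u r) ^ n" by (intro one_le_power cosh_real_ge_1)
    have "S r - S (r + m) \<le> (cosh (u r) ^ n - 1) *\<^sub>R S (r + m)"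
      using loss[of r m] by (simp add: scaleR_diff_left)
    also have "\<dots> \<le> (cosh (u r) ^ n - 1) *\<^sub>R S 0"
      using c1 by (intro scaleR_left_mono S_le) simp
    finally have "norm (S r - S (r + m)) \<le> norm ((cosh (u r) ^ n - 1) *\<^sub>R S 0)"
      using mono[of r m] by (intro op_norm_mono) simp_all
    thus ?thesis using c1 by simp
  qed
  have "(\<lambda>r. (cosh (u r) ^ n - 1) * norm (S 0)) \<longlonglongrightarrow> (cosh 0 ^ n - 1) * norm (S 0)"
    by (intro tendsto_intros u_lim)
  hence bound_lim: "(\<lambda>r. (cosh (u r) ^ n - 1) * norm (S 0)) \<longlonglongrightarrow> 0" by simp
  have "Cauchy S"
  proof (rule CauchyI')
    fix e :: real assume "0 < e"
    then obtain M where M: "\<And>r. r \<ge> M \<Longrightarrow> (cosh (u r) ^ n - 1) * norm (S 0) < e"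
      using order_tendstoD(2)[OF bound_lim] by (auto simp: eventually_sequentially)
    show "\<exists>M. \<forall>m\<ge>M. \<forall>k>m. dist (S m) (S k) < e"
    proof (intro exI allI impI)
      fix m k assume "M \<le> m" "m < k"
      thus "dist (S m) (S k) < e"
        using bound[of m "k - m"] M[of m] by (simp add: dist_norm)
    qed
  qed
  then obtain T where T: "S \<longlonglongrightarrow> T" using Cauchy_convergent convergent_def by blast
  define L where "L = (1 / real (Suc n)) *\<^sub>R T"
  have TL: "T = real (Suc n) *\<^sub>R L" by (simp add: L_def del: of_nat_Suc)
  have X_lim: "(\<lambda>r. X r i) \<longlonglongrightarrow> L" if i: "i < Suc n" for i
  proof -
    have lower: "S r \<le> exp (2 * u r) *\<^sub>R (real (Suc n) *\<^sub>R X r i)" for r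
    proof -
      have "S r \<le> (\<Sum>j<Suc n. exp (2 * u r) *\<^sub>R X r i)"
        unfolding S_def by (intro sum_mono spread i) simp
      thus ?thesis by (simp only: sum_constant_scaleR card_lessThan scaleR_left_commute)
    qed
    have upper: "real (Suc n) *\<^sub>R X r i \<le> exp (2 * u r) *\<^sub>R S r" for r
    proof -
      have "(\<Sum>j<Suc n. X r i) \<le> (\<Sum>j<Suc n. exp (2 * u r) *\<^sub>R X r j)"
        by (intro sum_mono spread i) simp
      thus ?thesis by (simp only: sum_constant_scaleR card_lessThan S_def scaleR_sum_right)
    qed
    \<comment> \<open>By the two bounds, \<open>n + 1\<close> times the entry lies above \<open>exp (- 2 u) S\<close> and exceeds it
      by at most \<open>(exp (2 u) - exp (- 2 u)) S\<close>.\<close>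
    have "(\<lambda>r. real (Suc n) *\<^sub>R X r i) \<longlonglongrightarrow> T"
    proof (rule op_squeeze[where Y = "\<lambda>r. exp (- 2 * u r) *\<^sub>R S r" and B = "S 0"
          and c = "\<lambda>r. exp (2 * u r) - exp (- 2 * u r)"])
      have "(\<lambda>r. exp (- 2 * u r) *\<^sub>R S r) \<longlonglongrightarrow> exp (- 2 * 0) *\<^sub>R T"
        by (intro tendsto_intros u_lim T)
      thus "(\<lambda>r. exp (- 2 * u r) *\<^sub>R S r) \<longlonglongrightarrow> T" by simp
      have "(\<lambda>r. exp (2 * u r) - exp (- 2 * u r)) \<longlonglongrightarrow> exp (2 * 0) - exp (- 2 * 0)"
        by (intro tendsto_intros u_lim)
      thus "(\<lambda>r. exp (2 * u r) - exp (- 2 * u r)) \<longlonglongrightarrow> 0" by simp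
      fix r
      have "exp (- 2 * u r) *\<^sub>R S r \<le> exp (- 2 * u r) *\<^sub>R (exp (2 * u r) *\<^sub>R (real (Suc n) *\<^sub>R X r i))"
        by (rule scaleR_left_mono[OF lower]) simp
      also have "exp (- 2 * u r) *\<^sub>R (exp (2 * u r) *\<^sub>R (real (Suc n) *\<^sub>R X r i)) = real (Suc n) *\<^sub>R X r i"
      proof -
        have "exp (- 2 * u r) * exp (2 * u r) = 1" by (simp flip: exp_add)
        thus ?thesis by (simp only: scaleR_scaleR mult.assoc[symmetric] mult_1_left)
      qed
      finally show "exp (- 2 * u r) *\<^sub>R S r \<le> real (Suc n) *\<^sub>R X r i" .
      have "real (Suc n) *\<^sub>R X r i - exp (- 2 * u r) *\<^sub>R S r
          \<le> exp (2 * u r) *\<^sub>R S r - exp (- 2 * u r) *\<^sub>R S r"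
        by (intro diff_right_mono upper)
      also have "\<dots> = (exp (2 * u r) - exp (- 2 * u r)) *\<^sub>R S r" by (simp only: scaleR_diff_left)
      also have "\<dots> \<le> (exp (2 * u r) - exp (- 2 * u r)) *\<^sub>R S 0"
        using u0[of r] by (intro scaleR_left_mono S_le) simp
      finally show "real (Suc n) *\<^sub>R X r i - exp (- 2 * u r) *\<^sub>R S r
          \<le> (exp (2 * u r) - exp (- 2 * u r)) *\<^sub>R S 0" .
    qed
    from tendsto_scaleR[OF tendsto_const this, of "1 / real (Suc n)"]
    show ?thesis by (simp add: L_def del: of_nat_Suc)
  qed
  have lower_bound: "total A \<le> (real (Suc n) * cosh s ^ n) *\<^sub>R L"
    if "0 \<le> s" "\<And>i j. i < Suc n \<Longrightarrow> j < Suc n \<Longrightarrow> A i \<le> exp (2 * s) *\<^sub>R A j" for s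
  proof -
    have "total A \<le> (cosh s ^ n) *\<^sub>R T"
    proof (rule op_le_tendsto[of "\<lambda>_. total A" _ "\<lambda>r. (cosh s ^ n) *\<^sub>R S r"])
      show "total A \<le> (cosh s ^ n) *\<^sub>R S r" for r
        unfolding S_def X_def by (rule total_le_iterate[OF A that])
    qed (intro tendsto_intros T)+
    thus ?thesis by (simp only: TL scaleR_scaleR mult.commute)
  qed
  show thesis
  proof (rule that)
    define k where "k = real (Suc n) * cosh t ^ n"
    have k: "0 < k" unfolding k_def by (intro mult_pos_pos zero_less_power) simp_all
    have "pos_def (k *\<^sub>R L)"
      using lower_bound[OF t le] S_pd[of 0] pos_def_mono unfolding S0 k_def by blast
    hence "pos_def ((1 / k) *\<^sub>R (k *\<^sub>R L))" by (rule pos_def_scaleR) (use k in simp)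
    thus "pos_def L" using k by simp
    show "\<forall>i<Suc n. (\<lambda>r. (step ^^ r) A i) \<longlonglongrightarrow> L"
      using X_lim by (simp add: X_def)
    have "T \<le> S 0" by (rule op_le_tendsto[OF T tendsto_const S_le])
    thus "real (Suc n) *\<^sub>R L \<le> total A" by (simp only: TL S0)
    show "\<forall>t\<ge>0. (\<forall>i<Suc n. \<forall>j<Suc n. A i \<le> exp (2 * t) *\<^sub>R A j)
      \<longrightarrow> total A \<le> (real (Suc n) * cosh t ^ n) *\<^sub>R L"
      using lower_bound by blast
  qed
qed

definition limit_mean :: "(nat \<Rightarrow> 'a bounded_op) \<Rightarrow> 'a bounded_op"
  where "limit_mean A = (THE L. \<forall>i<Suc n. (\<lambda>r. (step ^^ r) A i) \<longlonglongrightarrow> L)"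

lemma limit_mean_eqI:
  assumes "\<forall>i<Suc n. (\<lambda>r. (step ^^ r) A i) \<longlonglongrightarrow> L"
  shows "limit_mean A = L"
  unfolding limit_mean_def
proof (rule the_equality)
  show "\<forall>i<Suc n. (\<lambda>r. (step ^^ r) A i) \<longlonglongrightarrow> L" using assms by blast
  fix L' assume "\<forall>i<Suc n. (\<lambda>r. (step ^^ r) A i) \<longlonglongrightarrow> L'"
  hence "(\<lambda>r. (step ^^ r) A 0) \<longlonglongrightarrow> L'" by blast
  thus "L' = L" using assms LIMSEQ_unique by blast
qed

text \<open>The comparison principle passes to the limit because the exponents
  \<open>\<mu> + (- 1 / n) ^ r * (l i - \<mu>)\<close> of the iterates tend to the mean \<open>\<mu>\<close> of the \<open>l i\<close>; the two
  inequalities with the sum come with the limit from \<open>iterates_converge\<close>.\<close>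

theorem limit_mean_bounds: "geometric_mean_bounds (Suc n) limit_mean"
proof
  show "2 \<le> Suc n" using two_le by simp
next
  fix A :: "nat \<Rightarrow> 'a bounded_op" assume A: "\<And>i. i < Suc n \<Longrightarrow> pos_def (A i)"
  obtain L where L: "pos_def L" "\<forall>i<Suc n. (\<lambda>r. (step ^^ r) A i) \<longlonglongrightarrow> L"
    "real (Suc n) *\<^sub>R L \<le> total A"
    by (rule iterates_converge[OF A])
  thus "pos_def (limit_mean A)" "real (Suc n) *\<^sub>R limit_mean A \<le> total A"
    by (simp_all only: limit_mean_eqI[OF L(2)])
next
  fix A :: "nat \<Rightarrow> 'a bounded_op" and t :: real
  assume A: "\<And>i. i < Suc n \<Longrightarrow> pos_def (A i)" and t: "0 \<le> t"
    and le: "\<And>i j. i < Suc n \<Longrightarrow> j < Suc n \<Longrightarrow> A i \<le> exp (2 * t) *\<^sub>R A j"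
  obtain L where L: "\<forall>i<Suc n. (\<lambda>r. (step ^^ r) A i) \<longlonglongrightarrow> L"
    "\<forall>t\<ge>0. (\<forall>i<Suc n. \<forall>j<Suc n. A i \<le> exp (2 * t) *\<^sub>R A j)
      \<longrightarrow> total A \<le> (real (Suc n) * cosh t ^ n) *\<^sub>R L"
    by (rule iterates_converge[OF A])
  show "total A \<le> (real (Suc n) * cosh t ^ (Suc n - 1)) *\<^sub>R limit_mean A"
    unfolding limit_mean_eqI[OF L(1)] diff_Suc_1 using L(2) t le by blast
next
  fix A B :: "nat \<Rightarrow> 'a bounded_op" and \<sigma> l
  assume A: "\<And>i. i < Suc n \<Longrightarrow> pos_def (A i)" and B: "\<And>i. i < Suc n \<Longrightarrow> pos_def (B i)"
    and \<sigma>: "bij_betw \<sigma> {..<Suc n} {..<Suc n}"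
    and le: "\<And>i. i < Suc n \<Longrightarrow> A i \<le> exp (l i) *\<^sub>R B (\<sigma> i)"
  obtain L where L: "\<forall>i<Suc n. (\<lambda>r. (step ^^ r) A i) \<longlonglongrightarrow> L"
    by (rule iterates_converge[OF A])
  obtain M where M: "\<forall>i<Suc n. (\<lambda>r. (step ^^ r) B i) \<longlonglongrightarrow> M"
    by (rule iterates_converge[OF B])
  define \<mu> where "\<mu> = (\<Sum>k<Suc n. l k) / real (Suc n)"
  have "\<sigma> 0 < Suc n" using \<sigma> by (auto dest: bij_betwE)
  have "\<bar>- 1 / real n\<bar> < 1" using two_le by simp
  hence "(\<lambda>r. exp (\<mu> + (- 1 / real n) ^ r * (l 0 - \<mu>))) \<longlonglongrightarrow> exp (\<mu> + 0 * (l 0 - \<mu>))"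
    by (intro tendsto_intros LIMSEQ_power_zero) simp
  hence lim: "(\<lambda>r. exp (\<mu> + (- 1 / real n) ^ r * (l 0 - \<mu>))) \<longlonglongrightarrow> exp \<mu>" by simp
  have L0: "(\<lambda>r. (step ^^ r) A 0) \<longlonglongrightarrow> L" and M0: "(\<lambda>r. (step ^^ r) B (\<sigma> 0)) \<longlonglongrightarrow> M"
    using L M \<open>\<sigma> 0 < Suc n\<close> by auto
  have "L \<le> exp \<mu> *\<^sub>R M"
  proof (rule op_le_tendsto[OF L0 tendsto_scaleR[OF lim M0]])
    show "(step ^^ r) A 0 \<le> exp (\<mu> + (- 1 / real n) ^ r * (l 0 - \<mu>)) *\<^sub>R (step ^^ r) B (\<sigma> 0)" for r
      unfolding \<mu>_def by (rule iterate_compare[where l = l]) (simp_all only: A B \<sigma> le zero_less_Suc)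
  qed
  thus "limit_mean A \<le> exp ((\<Sum>i<Suc n. l i) / real (Suc n)) *\<^sub>R limit_mean B"
    unfolding limit_mean_eqI[OF L] limit_mean_eqI[OF M] \<mu>_def .
qed

end

lemma geometric_mean_bounds_geo_mean2:
  "geometric_mean_bounds 2 (\<lambda>A::nat \<Rightarrow> 'a::complex_hilbert_space bounded_op. A 0 \<sharp> A 1)"
proof
  fix A :: "nat \<Rightarrow> 'a bounded_op" assume A: "\<And>i. i < 2 \<Longrightarrow> pos_def (A i)"
  show "pos_def (A 0 \<sharp> A 1)" using A by (intro pos_def_geo_mean2) auto
  show "real 2 *\<^sub>R (A 0 \<sharp> A 1) \<le> (\<Sum>i<2. A i)"
    using A geo_mean2_le_arith_mean[of "A 0" "A 1"] by (simp add: numeral_2_eq_2)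
  fix t :: real assume t: "0 \<le> t"
    and le: "\<And>i j. i < 2 \<Longrightarrow> j < 2 \<Longrightarrow> A i \<le> exp (2 * t) *\<^sub>R A j"
  have "A 0 + A 1 \<le> (2 * cosh t) *\<^sub>R (A 0 \<sharp> A 1)"
    using A le by (intro arith_mean_le_cosh_geo_mean2 t) auto
  thus "(\<Sum>i<2. A i) \<le> (real 2 * cosh t ^ (2 - 1)) *\<^sub>R (A 0 \<sharp> A 1)"
    by (simp add: numeral_2_eq_2)
next
  fix A B :: "nat \<Rightarrow> 'a bounded_op" and \<sigma> l
  assume A: "\<And>i. i < 2 \<Longrightarrow> pos_def (A i)" and B: "\<And>i. i < 2 \<Longrightarrow> pos_def (B i)"
    and \<sigma>: "bij_betw \<sigma> {..<2::nat} {..<2}"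
    and le: "\<And>i. i < 2 \<Longrightarrow> A i \<le> exp (l i) *\<^sub>R B (\<sigma> i)"
  have two: "{..<2::nat} = {0, 1}" by auto
  have \<sigma>01: "\<sigma> 0 \<in> {0, 1}" "\<sigma> 1 \<in> {0, 1}" "\<sigma> 0 \<noteq> \<sigma> 1"
    using \<sigma> unfolding two bij_betw_def inj_on_def by auto
  have "A 0 \<sharp> A 1 \<le> exp ((l 0 + l 1) / 2) *\<^sub>R (B (\<sigma> 0) \<sharp> B (\<sigma> 1))"
    using \<sigma>01 by (intro geo_mean2_compare A B le) auto
  also have "B (\<sigma> 0) \<sharp> B (\<sigma> 1) = B 0 \<sharp> B 1"
    using \<sigma>01 B geo_mean2_commute[of "B 0" "B 1"] by auto
  finally show "A 0 \<sharp> A 1 \<le> exp ((\<Sum>i<2. l i) / real 2) *\<^sub>R (B 0 \<sharp> B 1)"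
    by (simp add: numeral_2_eq_2)
qed simp

theorem geometric_mean_bounds_alm_mean:
  "2 \<le> n \<Longrightarrow> geometric_mean_bounds n
    (alm_mean n :: (nat \<Rightarrow> 'a::complex_hilbert_space bounded_op) \<Rightarrow> 'a bounded_op)"
proof (induction n rule: nat_induct_at_least)
  case base
  have "(alm_mean 2 :: (nat \<Rightarrow> 'a bounded_op) \<Rightarrow> 'a bounded_op) = (\<lambda>A. A 0 \<sharp> A 1)"
    by (simp add: numeral_2_eq_2)
  thus ?case using geometric_mean_bounds_geo_mean2 by simp
next
  case (Suc n)
  interpret geometric_mean_bounds n "alm_mean n :: (nat \<Rightarrow> 'a bounded_op) \<Rightarrow> 'a bounded_op"
    by (rule Suc.IH)
  have "alm_mean (Suc n) = limit_mean"
    using Suc.hyps by (simp add: limit_mean_def fun_eq_iff)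
  thus ?case using limit_mean_bounds by simp
qed

section \<open>The spectral radius as an order bound\<close>

lemma scaleC_times_left: "(c *\<^sub>C S) * T = c *\<^sub>C (S * (T :: 'a::complex_hilbert_space bounded_op))"
  by (rule op_eqI) (simp add: op_apply_scaleC)

lemma scaleC_times_right: "S * (c *\<^sub>C T) = c *\<^sub>C (S * (T :: 'a::complex_hilbert_space bounded_op))"
  by (rule op_eqI) (simp add: op_apply_scaleC op_apply_scaleC_right)

lemma op_norm_scaleC_le: "norm (c *\<^sub>C T) \<le> cmod c * norm (T :: 'a::complex_hilbert_space bounded_op)"
proof (rule norm_op_bound)
  fix x
  have "norm (op_apply (c *\<^sub>C T) x) = cmod c * norm (op_apply T x)"
    by (simp add: op_apply_scaleC norm_scaleC)
  also have "\<dots> \<le> cmod c * (norm T * norm x)"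
    by (intro mult_left_mono norm_op_apply) simp
  finally show "norm (op_apply (c *\<^sub>C T) x) \<le> cmod c * norm T * norm x"
    by (simp add: mult.assoc)
qed simp

lemma cmod_spectrum_le_norm:
  assumes "c \<in> op_spectrum T"
  shows "cmod c \<le> norm T"
proof (rule ccontr)
  assume "\<not> cmod c \<le> norm T"
  hence lt: "norm T < cmod c" by simp
  hence c: "c \<noteq> 0" by auto
  define X where "X = (1 / c) *\<^sub>C T"
  have "norm X \<le> cmod (1 / c) * norm T" unfolding X_def by (rule op_norm_scaleC_le)
  also have "\<dots> < 1" using lt c by (simp add: norm_divide field_simps)
  finally obtain Y where Y: "Y * (1 - X) = 1" "(1 - X) * Y = 1"
    using op_invertible_one_minus by (auto simp: op_invertible_def is_op_inverse_def)
  have diff: "c *\<^sub>C (x - y) = c *\<^sub>C x - c *\<^sub>C y" for x y :: 'a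
    by (rule linear_diff[OF bounded_linear.linear[OF bounded_linear_scaleC]])
  have T: "T - c *\<^sub>C 1 = c *\<^sub>C (X - 1)"
    using c by (intro op_eqI) (simp add: X_def op_apply_scaleC diff)
  have Y': "- Y * (X - 1) = 1" "(X - 1) * - Y = 1"
    using Y by (simp_all add: left_diff_distrib right_diff_distrib)
  have "op_invertible (T - c *\<^sub>C 1)"
    by (rule op_invertibleI[of "(1 / c) *\<^sub>C (- Y)"])
       (use c in \<open>simp_all only: T scaleC_times_left scaleC_times_right Y' scaleC_scaleC, simp_all\<close>)
  thus False using assms by (simp add: op_spectrum_def)
qed

text \<open>Let \<open>c \<ge> 0\<close> be the least number with \<open>B \<le> c A\<close>. Then \<open>c A - B\<close> is positive but not invertible,
  since otherwise \<open>c\<close> could be decreased. Hence \<open>c\<close> lies in the spectrum of \<open>A\<inverse> B\<close>.\<close>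

lemma le_spectral_radius_scaleR:
  fixes A B :: "'a::{complex_hilbert_space, nonzero_space} bounded_op"
  assumes A: "pos_def A" and B: "pos_def B"
  shows "B \<le> spectral_radius (op_inv A * B) *\<^sub>R A"
proof -
  have inv: "op_invertible A" by (rule pos_def_invertible[OF A])
  obtain e where e: "e > 0" "e *\<^sub>R 1 \<le> A"
    using A by (auto simp: pos_def_iff_bounded_below)
  have "B \<le> norm B *\<^sub>R 1" by (rule hermitian_le_norm[OF pos_def_hermitian[OF B]])
  also have "\<dots> = (norm B / e) *\<^sub>R (e *\<^sub>R (1 :: 'a bounded_op))" using e by simp
  also have "\<dots> \<le> (norm B / e) *\<^sub>R A" using e by (intro scaleR_left_mono) auto
  finally have "B \<le> (norm B / e) *\<^sub>R A" .
  then obtain c where c: "0 \<le> c" "B \<le> c *\<^sub>R A"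
    and c_min: "\<And>d. 0 \<le> d \<Longrightarrow> B \<le> d *\<^sub>R A \<Longrightarrow> c \<le> d"
    by - (rule least_multiple[of "norm B / e" B A], use e in simp_all)
  have "complex_of_real c \<in> op_spectrum (op_inv A * B)"
  proof (rule ccontr)
    assume "complex_of_real c \<notin> op_spectrum (op_inv A * B)"
    hence "op_invertible (op_inv A * B - c *\<^sub>R 1)"
      by (simp add: op_spectrum_def scaleR_scaleC)
    hence "op_invertible (A * ((-1) *\<^sub>R (op_inv A * B - c *\<^sub>R 1)))"
      by (intro op_invertible_mult inv op_invertible_scaleR) auto
    also have "A * ((-1) *\<^sub>R (op_inv A * B - c *\<^sub>R 1)) = c *\<^sub>R A - (A * op_inv A) * B"
      by (simp add: right_diff_distrib mult.assoc)
    finally have "pos_def (c *\<^sub>R A - B)"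
      using c(2) by (simp add: pos_def_def op_inv_right[OF inv])
    then obtain d where d: "d > 0" "d *\<^sub>R 1 \<le> c *\<^sub>R A - B"
      by (auto simp: pos_def_iff_bounded_below)
    have nA: "norm A > 0"
    proof -
      have "A \<noteq> 0" using op_inv_left[OF inv] by auto
      thus ?thesis by simp
    qed
    define r where "r = d / norm A"
    have r: "r > 0" using d nA by (simp add: r_def)
    have "r *\<^sub>R A \<le> r *\<^sub>R (norm A *\<^sub>R 1)"
      using r by (intro scaleR_left_mono hermitian_le_norm pos_def_hermitian A) simp
    also have "\<dots> = d *\<^sub>R 1" using nA by (simp add: r_def)
    also note d(2)
    finally have le: "B \<le> (c - r) *\<^sub>R A" by (simp add: scaleR_diff_left le_diff_eq add.commute)
    have "0 \<le> c - r"
    proof (rule ccontr)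
      assume "\<not> 0 \<le> c - r"
      hence "(c - r) *\<^sub>R A \<le> 0 *\<^sub>R A" by (intro scaleR_right_mono pos_def_nonneg A) simp
      with le have "B \<le> 0" by simp
      hence "B = 0" using pos_def_nonneg[OF B] by (rule order_antisym)
      thus False using op_inv_left[OF pos_def_invertible[OF B]] by simp
    qed
    hence "c \<le> c - r" using le by (rule c_min)
    thus False using r by simp
  qed
  moreover have "bdd_above (cmod ` op_spectrum (op_inv A * B))"
    by (rule bdd_aboveI2[of _ _ "norm (op_inv A * B)"]) (rule cmod_spectrum_le_norm)
  ultimately have "cmod (complex_of_real c) \<le> spectral_radius (op_inv A * B)"
    unfolding spectral_radius_def by (rule cSUP_upper)
  hence "c \<le> spectral_radius (op_inv A * B)" using c(1) by simp
  hence "c *\<^sub>R A \<le> spectral_radius (op_inv A * B) *\<^sub>R A"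
    by (rule scaleR_right_mono) (rule pos_def_nonneg[OF A])
  with c(2) show ?thesis by (rule order_trans)
qed

section \<open>Unital positive maps and the geometric mean\<close>

lemma
  assumes "unital_positive_map \<Phi>"
  shows unital_positive_map_add: "\<Phi> (X + Y) = \<Phi> X + \<Phi> Y"
    and unital_positive_map_scaleR: "\<Phi> (r *\<^sub>R X) = r *\<^sub>R \<Phi> X"
    and unital_positive_map_diff: "\<Phi> (X - Y) = \<Phi> X - \<Phi> Y"
    and unital_positive_map_one: "\<Phi> 1 = 1"
proof -
  have lin: "Vector_Spaces.linear scaleC scaleC \<Phi>" and one: "\<Phi> 1 = 1"
    using assms by (auto simp: unital_positive_map_def)
  interpret \<Phi>: Vector_Spaces.linear scaleC scaleC \<Phi> by (rule lin)
  show "\<Phi> (X + Y) = \<Phi> X + \<Phi> Y" "\<Phi> (X - Y) = \<Phi> X - \<Phi> Y" "\<Phi> (r *\<^sub>R X) = r *\<^sub>R \<Phi> X" "\<Phi> 1 = 1"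
    by (simp_all only: \<Phi>.add \<Phi>.diff \<Phi>.scale scaleR_scaleC one)
qed

lemma unital_positive_map_mono:
  assumes "unital_positive_map \<Phi>" and "X \<le> Y"
  shows "\<Phi> X \<le> \<Phi> Y"
proof -
  have "0 \<le> \<Phi> (Y - X)" using assms by (simp add: unital_positive_map_def)
  thus ?thesis by (simp add: unital_positive_map_diff[OF assms(1)])
qed

lemma unital_positive_map_sum:
  assumes "unital_positive_map \<Phi>"
  shows "\<Phi> (\<Sum>i<n. A i) = (\<Sum>i<n::nat. \<Phi> (A i))"
proof (induction n)
  case 0
  show ?case using unital_positive_map_scaleR[OF assms, of 0 0] by simp
qed (simp add: unital_positive_map_add[OF assms])

lemma unital_positive_map_pos_def:
  assumes "unital_positive_map \<Phi>" and "pos_def X"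
  shows "pos_def (\<Phi> X)"
proof -
  obtain e where e: "e > 0" "e *\<^sub>R 1 \<le> X"
    using assms(2) by (auto simp: pos_def_iff_bounded_below)
  have "e *\<^sub>R 1 \<le> \<Phi> X"
    using unital_positive_map_mono[OF assms(1) e(2)]
    by (simp add: unital_positive_map_scaleR[OF assms(1)] unital_positive_map_one[OF assms(1)])
  thus ?thesis using e(1) by (auto simp: pos_def_iff_bounded_below)
qed

lemma cosh_half_ln:
  assumes "0 < h"
  shows "1 / cosh (ln h / 2) = 2 * sqrt h / (1 + h)"
proof -
  have "exp (ln h / 2) = sqrt h"
    using assms by (simp add: ln_sqrt[symmetric])
  hence "cosh (ln h / 2) = (sqrt h + 1 / sqrt h) / 2"
    by (simp add: cosh_def exp_minus field_simps)
  also have "\<dots> = (1 + h) / (2 * sqrt h)"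
    using assms by (simp add: field_simps)
  finally show ?thesis by simp
qed

text \<open>With \<open>h = exp (2 t)\<close>, the reverse inequality loses the factor \<open>cosh t\<close> to the power
  \<open>n - 1\<close>; the inequality for the images \<open>\<Phi> (A i)\<close> loses nothing.\<close>

theorem theorem5:
  fixes \<Phi> :: "'h::{complex_hilbert_space, nonzero_space} bounded_op \<Rightarrow> 'h bounded_op"
    and n :: nat
    and A :: "nat \<Rightarrow> 'h bounded_op"
    and h :: real
  assumes "unital_positive_map \<Phi>"
    and "n \<ge> 2"
    and "\<And>i. i < n \<Longrightarrow> pos_def (A i)"
    and "h = Max {R_dist (A i) (A j) | i j. i < n \<and> j < n}"
  shows "\<Phi> (alm_mean n A) \<ge>
    ((2 * sqrt h / (1 + h)) ^ (n - 1)) *\<^sub>R alm_mean n (\<lambda>i. \<Phi> (A i))"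
proof -
  interpret geometric_mean_bounds n "alm_mean n :: (nat \<Rightarrow> 'h bounded_op) \<Rightarrow> 'h bounded_op"
    by (rule geometric_mean_bounds_alm_mean[OF assms(2)])
  note \<Phi> = assms(1) and A = assms(3)
  have le_h: "A i \<le> h *\<^sub>R A j" if ij: "i < n" "j < n" for i j
  proof -
    have fin: "finite {R_dist (A i) (A j) | i j. i < n \<and> j < n}"
      by (rule finite_subset[of _ "(\<lambda>(i, j). R_dist (A i) (A j)) ` ({..<n} \<times> {..<n})"]) auto
    have "A i \<le> spectral_radius (op_inv (A j) * A i) *\<^sub>R A j"
      by (intro le_spectral_radius_scaleR A ij)
    also have "\<dots> \<le> R_dist (A i) (A j) *\<^sub>R A j"
      by (intro scaleR_right_mono pos_def_nonneg A ij) (simp add: R_dist_def)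
    also have "\<dots> \<le> h *\<^sub>R A j"
    proof (rule scaleR_right_mono)
      show "R_dist (A i) (A j) \<le> h"
        unfolding assms(4) using ij by (intro Max_ge fin) blast
    qed (rule pos_def_nonneg[OF A[OF ij(2)]])
    finally show ?thesis .
  qed
  have n0: "0 < n" using assms(2) by simp
  \<comment> \<open>Comparing \<open>A 0\<close> with itself shows \<open>1 \<le> h\<close>.\<close>
  have h1: "1 \<le> h"
  proof (rule ccontr)
    assume "\<not> 1 \<le> h"
    have "pos_def ((1 - h) *\<^sub>R A 0)" using \<open>\<not> 1 \<le> h\<close> by (intro pos_def_scaleR A n0) simp
    moreover have "(1 - h) *\<^sub>R A 0 \<le> 0" using le_h[OF n0 n0] by (simp add: scaleR_diff_left)
    ultimately have "(1 - h) *\<^sub>R A 0 = 0" by (intro order_antisym pos_def_nonneg)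
    hence "A 0 = 0" using \<open>\<not> 1 \<le> h\<close> by simp
    thus False using op_inv_left[OF pos_def_invertible[OF A[OF n0]]] by simp
  qed
  define t where "t = ln h / 2"
  define c where "c = cosh t ^ (n - 1)"
  have t: "0 \<le> t" "exp (2 * t) = h" using h1 by (simp_all add: t_def)
  have c: "0 < c" by (simp add: c_def)
  have "(\<Sum>i<n. A i) \<le> (real n * c) *\<^sub>R alm_mean n A"
    unfolding c_def by (rule sum_le_mean) (simp_all only: A t le_h)
  from unital_positive_map_mono[OF \<Phi> this]
  have "(\<Sum>i<n. \<Phi> (A i)) \<le> (real n * c) *\<^sub>R \<Phi> (alm_mean n A)"
    by (simp only: unital_positive_map_sum[OF \<Phi>] unital_positive_map_scaleR[OF \<Phi>])
  moreover have "real n *\<^sub>R alm_mean n (\<lambda>i. \<Phi> (A i)) \<le> (\<Sum>i<n. \<Phi> (A i))"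
    by (intro mean_le_sum unital_positive_map_pos_def[OF \<Phi>] A)
  ultimately have "real n *\<^sub>R alm_mean n (\<lambda>i. \<Phi> (A i)) \<le> (real n * c) *\<^sub>R \<Phi> (alm_mean n A)"
    by (rule order_trans[rotated])
  hence "(1 / (real n * c)) *\<^sub>R (real n *\<^sub>R alm_mean n (\<lambda>i. \<Phi> (A i)))
      \<le> (1 / (real n * c)) *\<^sub>R ((real n * c) *\<^sub>R \<Phi> (alm_mean n A))"
    by (rule scaleR_left_mono) (use c in simp)
  hence "(1 / c) *\<^sub>R alm_mean n (\<lambda>i. \<Phi> (A i)) \<le> \<Phi> (alm_mean n A)"
    using c n0 by simp
  moreover have "1 / c = (2 * sqrt h / (1 + h)) ^ (n - 1)"
    using cosh_half_ln[of h] h1 by (simp add: c_def t_def flip: power_one_over)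
  ultimately show ?thesis by simp
qed

end
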